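(* Let $(X,X^+)$ be a separable ordered Banach space with $\dim X\ge 2$ and $X^+$ total, and let $\Phi=((U_\omega(t))_{\omega\in\Omega,t\in\mathbb T^+},(\theta_t)_{t\in\mathbb T})$ be a measurable linear skew-product semidynamical system on $X$ that is integrable, injective, compact and positive. Assume that case (O2) or case (O3) of the Oseledets alternative occurs, with $\Omega_0$ and $E_1(\omega)$ ($\omega\in\Omega_0$) as there. Then the set $\Omega_1$ of those $\omega\in\Omega_0$ such that $E_1(\omega)\cap X^+\supsetneq\{0\}$ has $\mathbb P$-measure one, and for each $\omega\in\Omega_1$ there exists an entire orbit $v_\omega:\mathbb T\to X^+$ of $U_\omega$ such that $$v_\omega(t)\in (E_1(\theta_t\omega)\cap X^+)\setminus\{0\}\qquad\text{for all } t\in\mathbb T.$$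
   Context: Let $\mathbb T\in\{\mathbb Z,\mathbb R\}$, $\mathbb T^+=\{t\in\mathbb T:t\ge0\}$. $(\Omega,\mathfrak F,\mathbb P)$ is a probability space; $\mathfrak B(Y)$ is the Borel $\sigma$-algebra of a metric space $Y$. A metric dynamical system $(\theta_t)_{t\in\mathbb T}$ is a $(\mathfrak B(\mathbb T)\otimes\mathfrak F,\mathfrak F)$-measurable map $(t,\omega)\mapsto\theta_t\omega$ with $\theta_0=\mathrm{Id}$, $\theta_{t_1+t_2}=\theta_{t_2}\circ\theta_{t_1}$, each $\theta_t$ preserving $\mathbb P$. $\Omega'\subset\Omega$ is invariant if $\theta_t(\Omega')=\Omega'$ for all $t\in\mathbb T$; the system is ergodic if every invariant $F\in\mathfrak F$ has $\mathbb P(F)\in\{0,1\}$. A measurable linear skew-product semidynamical system $\Phi=((U_\omega(t)),(\theta_t))$ on a real Banach space $X$ covering $(\theta_t)$ is a $(\mathfrak B(\mathbb T^+)\otimes\mathfrak F\otimes\mathfrak B(X),\mathfrak B(X))$-measurable map $(t,\omega,u)\mapsto U_\omega(t)u$ with each $U_\omega(t)$ bounded linear on $X$, $U_\omega(0)=\mathrm{Id}_X$ and $U_{\theta_s\omega}(t)U_\omega(s)=U_\omega(t+s)$. Write $\ln^+x=\max(\ln x,0)$, $\ln^+0=0$, $\ln 0=-\infty$. A cone in $X$ is a closed convex set $X^+$ with $\alpha u\in X^+$ for $\alpha\ge0$, $u\in X^+$, and $X^+\cap(-X^+)=\{0\}$; $(X,X^+)$ is then an ordered Banach space and $u\le v$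 means $v-u\in X^+$. $X^+$ is total if $X^+-X^+$ is dense in $X$. $\Phi$ is integrable if $X$ is separable, $(\theta_t)$ is ergodic, $\mathbb P$ is complete when $\mathbb T=\mathbb R$, and: when $\mathbb T=\mathbb Z$, $\omega\mapsto\ln^+\|U_\omega(1)\|$ is in $L_1$; when $\mathbb T=\mathbb R$, $\omega\mapsto\sup_{0\le s\le1}\ln^+\|U_\omega(s)\|$ and $\omega\mapsto\sup_{0\le s\le1}\ln^+\|U_{\theta_s\omega}(1-s)\|$ are in $L_1$. It is injective if $U_\omega(1)$ is injective for a.e. $\omega$; compact if $U_\omega(1)$ is completely continuous (maps bounded sets to relatively compact sets) for a.e. $\omega$; positive if $U_\omega(t)u_1\le U_\omega(t)u_2$ for all $\omega$, all $t\in\mathbb T^+$ and all $u_1\le u_2$. An entire orbit of $U_\omega$ is a map $v_\omega:\mathbb T\to X$ with $v_\omega(s+t)=U_{\theta_s\omega}(t)v_\omega(s)$ for all $s\in\mathbb T$, $t\in\mathbb T^+$. Oseledets alternative. A family $\{E(\omega)\}_{\omega\in\Omega_0}$ of $l$-dimensional subspaces is measurable if there are measurable $v_1,\dots,v_l:\Omega_0\to X$ forming a basis of $E(\omega)$ for each $\omega$. For a decomposition $E(\omega)\oplus F(\omega)=X$ (with $E(\omega)$ finite-dimensional, $F(\omega)$ closed) the associated projection $P(\omega)$ is onto $F(\omega)$ along $E(\omega)$; the family is strongly measurable if $\omega\mapsto P(\omega)u$ is measurable for each $u$, and tempered if $\lim_{t\to\pm\infty}\frac1t\ln\|P(\theta_t\omega)\|=0$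 a.s. It is known (Lian–Lu) that if $\Phi$ is integrable, injective and compact then there is an invariant $\Omega_0$ with $\mathbb P(\Omega_0)=1$ for which exactly one of the following holds (for all $\omega\in\Omega_0$, $t\in\mathbb T^+$): (O1) $\lim_{t\to\infty}\frac1t\ln\|U_\omega(t)\|=-\infty$. (O2) There are $k\ge1$, reals $\lambda_1>\dots>\lambda_k$, measurable families $E_1,\dots,E_k$ of finite-dimensional subspaces and a family $F_\infty$ of closed finite-codimensional subspaces with $U_\omega(t)E_i(\omega)=E_i(\theta_t\omega)$, $U_\omega(t)F_\infty(\omega)\subset F_\infty(\theta_t\omega)$, $E_1(\omega)\oplus\dots\oplus E_k(\omega)\oplus F_\infty(\omega)=X$; with $F_i(\omega):=E_{i+1}(\omega)\oplus\dots\oplus E_k(\omega)\oplus F_\infty(\omega)$ (so $F_k=F_\infty$) the projections associated with $(E_1\oplus\dots\oplus E_i)\oplus F_i=X$ are strongly measurable and tempered, $i=1,\dots,k$; $\lim_{t\to\pm\infty}\frac1t\ln\|U_\omega(t)|_{E_i(\omega)}\|=\lim_{t\to\pm\infty}\frac1t\ln\|U_\omega(t)u\|=\lambda_i$ for nonzero $u\in E_i(\omega)$; $\lim_{t\to\infty}\frac1t\ln\|U_\omega(t)u\|=\lambda_i$ for $u\in(E_i(\omega)\oplus F_i(\omega))\setminus F_i(\omega)$; and $\lim_{t\to\infty}\frac1t\ln\|U_\omega(t)|_{F_\infty(\omega)}\|=-\infty$. (O3) There are reals $\lambda_1>\lambda_2>\dots$ tending to $-\infty$, measurable families $E_1,E_2,\dots$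 of finite-dimensional subspaces and families $F_1,F_2,\dots$ of closed finite-codimensional subspaces with $U_\omega(t)E_i(\omega)=E_i(\theta_t\omega)$, $U_\omega(t)F_i(\omega)\subset F_i(\theta_t\omega)$, $E_1(\omega)\oplus\dots\oplus E_i(\omega)\oplus F_i(\omega)=X$, $F_i(\omega)=E_{i+1}(\omega)\oplus F_{i+1}(\omega)$, the projections associated with $(E_1\oplus\dots\oplus E_i)\oplus F_i=X$ strongly measurable and tempered; $\lim_{t\to\pm\infty}\frac1t\ln\|U_\omega(t)|_{E_i(\omega)}\|=\lim_{t\to\pm\infty}\frac1t\ln\|U_\omega(t)u\|=\lambda_i$ for nonzero $u\in E_i(\omega)$; $\lim_{t\to\infty}\frac1t\ln\|U_\omega(t)u\|=\lambda_i$ for $u\in(E_i(\omega)\oplus F_i(\omega))\setminus F_i(\omega)$; and $\lim_{t\to\infty}\frac1t\ln\|U_\omega(t)|_{F_i(\omega)}\|=\lambda_{i+1}$. For $t=-s<0$ and $u\in E_i(\omega)$, $U_\omega(t)u$ denotes the unique $v\in E_i(\theta_t\omega)$ with $U_{\theta_t\omega}(s)v=u$.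
   Formalization: The entire orbits are asserted for each ω in Ω₁ only after replacing Ω₀ by some invariant full-measure subset carrying the same alternative and E_i; for an arbitrary admissible Ω₀ that clause can fail on a null set of orbits. *)

theory Defs
  imports "HOL-Probability.Probability"
begin

section \<open>Time and extended logarithms\<close>

text \<open>Both time sets are subsets \<open>T\<close> of the reals, with \<open>T = \<int>\<close> or \<open>T = UNIV\<close>. The filters below
  are those of the limits along \<open>t \<in> T\<close>, \<open>t \<rightarrow> \<plusminus>\<infinity>\<close>.\<close>

definition nonneg_times :: "real set \<Rightarrow> real set" where
  "nonneg_times T = T \<inter> {0..}"

definition at_top_in :: "real set \<Rightarrow> real filter" where
  "at_top_in T = inf at_top (principal T)"

definition at_bot_in :: "real set \<Rightarrow> real filter" where
  "at_bot_in T = inf at_bot (principal T)"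

text \<open>On the reals the library sets \<open>ln 0 = 0\<close>, so \<open>ln_plus 0 = 0\<close> as required; growth rates on the
  other hand need \<open>ln 0 = -\<infinity>\<close>.\<close>

definition ln_plus :: "real \<Rightarrow> real" where
  "ln_plus x = max (ln x) 0"

definition ln_ext :: "real \<Rightarrow> ereal" where
  "ln_ext x = (if x \<le> 0 then -\<infinity> else ereal (ln x))"

text \<open>\<open>growth_rate_to F g r\<close>: \<open>1/t ln (g t)\<close> tends to \<open>r\<close> along \<open>F\<close>.\<close>

definition growth_rate_to :: "real filter \<Rightarrow> (real \<Rightarrow> real) \<Rightarrow> ereal \<Rightarrow> bool" where
  "growth_rate_to F g r \<longleftrightarrow> ((\<lambda>t. ereal (1 / t) * ln_ext (g t)) \<longlongrightarrow> r) F"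


section \<open>Subspaces and direct sums\<close>

text \<open>Sums of subspaces are the elementwise sums of sets from \<^theory>\<open>HOL-Library.Set_Algebras\<close>;
  the empty sum is \<open>{0}\<close>.\<close>

definition direct_sum :: "'i set \<Rightarrow> ('i \<Rightarrow> 'a::real_vector set) \<Rightarrow> 'a set \<Rightarrow> bool" where
  "direct_sum I V W \<longleftrightarrow>
     (\<Sum>i\<in>I. V i) = W \<and>
     (\<forall>x. (\<forall>i\<in>I. x i \<in> V i) \<and> (\<Sum>i\<in>I. x i) = 0 \<longrightarrow> (\<forall>i\<in>I. x i = 0))"

definition direct_sum2 :: "'a::real_vector set \<Rightarrow> 'a set \<Rightarrow> 'a set \<Rightarrow> bool" where
  "direct_sum2 A B W \<longleftrightarrow> A + B = W \<and> A \<inter> B = {0}"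

definition finite_codim :: "'a::real_vector set \<Rightarrow> bool" where
  "finite_codim F \<longleftrightarrow> (\<exists>B. finite B \<and> span (F \<union> B) = UNIV)"

text \<open>The projection onto \<open>F\<close> along \<open>E\<close>.\<close>

definition projection_onto :: "'a::real_vector set \<Rightarrow> 'a set \<Rightarrow> 'a \<Rightarrow> 'a" where
  "projection_onto F E u = (THE w. w \<in> F \<and> u - w \<in> E)"

text \<open>Operator norm of the restriction of \<open>f\<close> to a subspace \<open>E\<close>, defined in the same way as
  \<^const>\<open>onorm\<close>. It is \<open>0\<close> for \<open>E = {0}\<close>.\<close>

definition onorm_on :: "'a::real_normed_vector set \<Rightarrow> ('a \<Rightarrow> 'b::real_normed_vector) \<Rightarrow> real" where
  "onorm_on E f = (SUP x\<in>E. norm (f x) / norm x)"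


section \<open>Cones\<close>

definition order_cone :: "'a::real_normed_vector set \<Rightarrow> bool" where
  "order_cone C \<longleftrightarrow> closed C \<and> convex_cone C \<and> C \<inter> uminus ` C = {0}"

definition total_cone :: "'a::real_normed_vector set \<Rightarrow> bool" where
  "total_cone C \<longleftrightarrow> closure {u - v |u v. u \<in> C \<and> v \<in> C} = UNIV"


section \<open>Metric dynamical systems\<close>

locale metric_dynamical_system = prob_space M
  for M :: "'w measure" and T :: "real set" and \<theta> :: "real \<Rightarrow> 'w \<Rightarrow> 'w" +
  assumes time_set: "T = \<int> \<or> T = UNIV"
    and flow_measurable: "(\<lambda>(t, \<omega>). \<theta> t \<omega>) \<in> restrict_space borel T \<Otimes>\<^sub>M M \<rightarrow>\<^sub>M M"
    and flow_0: "\<And>\<omega>. \<omega> \<in> space M \<Longrightarrow> \<theta> 0 \<omega> = \<omega>"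
    and flow_add: "\<And>t1 t2 \<omega>. t1 \<in> T \<Longrightarrow> t2 \<in> T \<Longrightarrow> \<omega> \<in> space M \<Longrightarrow> \<theta> (t1 + t2) \<omega> = \<theta> t2 (\<theta> t1 \<omega>)"
    and flow_preserves: "\<And>t. t \<in> T \<Longrightarrow> distr M M (\<theta> t) = M"

definition invariant_set :: "real set \<Rightarrow> (real \<Rightarrow> 'w \<Rightarrow> 'w) \<Rightarrow> 'w set \<Rightarrow> bool" where
  "invariant_set T \<theta> A \<longleftrightarrow> (\<forall>t\<in>T. \<theta> t ` A = A)"

definition ergodic_flow :: "'w measure \<Rightarrow> real set \<Rightarrow> (real \<Rightarrow> 'w \<Rightarrow> 'w) \<Rightarrow> bool" where
  "ergodic_flow M T \<theta> \<longleftrightarrow> (\<forall>A\<in>sets M. invariant_set T \<theta> A \<longrightarrow> measure M A \<in> {0, 1})"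


section \<open>Linear skew-product semidynamical systems\<close>

text \<open>\<open>U \<omega> t\<close> is only meaningful for \<open>\<omega> \<in> space M\<close> and \<open>t \<in> nonneg_times T\<close>. A metrizable space is
  separable iff it is second countable, so separability of the Banach space is expressed by the
  type class.\<close>

locale linear_skew_product = metric_dynamical_system M T \<theta>
  for M :: "'w measure" and T :: "real set" and \<theta> :: "real \<Rightarrow> 'w \<Rightarrow> 'w" +
  fixes U :: "'w \<Rightarrow> real \<Rightarrow> 'a::{banach, second_countable_topology} \<Rightarrow> 'a"
  assumes cocycle_measurable:
      "(\<lambda>((t, \<omega>), u). U \<omega> t u) \<in> (restrict_space borel (nonneg_times T) \<Otimes>\<^sub>M M) \<Otimes>\<^sub>M borel \<rightarrow>\<^sub>M borel"
    and cocycle_linear: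
      "\<And>\<omega> t. \<omega> \<in> space M \<Longrightarrow> t \<in> nonneg_times T \<Longrightarrow> bounded_linear (U \<omega> t)"
    and cocycle_0: "\<And>\<omega> u. \<omega> \<in> space M \<Longrightarrow> U \<omega> 0 u = u"
    and cocycle_add:
      "\<And>\<omega> s t u. \<omega> \<in> space M \<Longrightarrow> s \<in> nonneg_times T \<Longrightarrow> t \<in> nonneg_times T \<Longrightarrow>
         U (\<theta> s \<omega>) t (U \<omega> s u) = U \<omega> (t + s) u"

text \<open>The suprema over \<open>[0, 1]\<close> are taken in \<open>[0, \<infinity>]\<close>, since a supremum of an unbounded set of reals
  is meaningless; \<open>L\<^sub>1\<close> for them means measurable with finite integral.\<close>

definition L1_ennreal :: "'w measure \<Rightarrow> ('w \<Rightarrow> ennreal) \<Rightarrow> bool" where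
  "L1_ennreal M f \<longleftrightarrow> f \<in> borel_measurable M \<and> (\<integral>\<^sup>+ \<omega>. f \<omega> \<partial>M) < \<infinity>"

definition integrable_system ::
  "'w measure \<Rightarrow> real set \<Rightarrow> (real \<Rightarrow> 'w \<Rightarrow> 'w) \<Rightarrow>
   ('w \<Rightarrow> real \<Rightarrow> 'a::{banach, second_countable_topology} \<Rightarrow> 'a) \<Rightarrow> bool" where
  "integrable_system M T \<theta> U \<longleftrightarrow>
     ergodic_flow M T \<theta> \<and>
     (T = \<int> \<longrightarrow> integrable M (\<lambda>\<omega>. ln_plus (onorm (U \<omega> 1)))) \<and>
     (T = UNIV \<longrightarrow>
        complete_measure M \<and>
        L1_ennreal M (\<lambda>\<omega>. SUP s\<in>{0..1}. ennreal (ln_plus (onorm (U \<omega> s)))) \<and>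
        L1_ennreal M (\<lambda>\<omega>. SUP s\<in>{0..1}. ennreal (ln_plus (onorm (U (\<theta> s \<omega>) (1 - s))))))"

definition injective_system :: "'w measure \<Rightarrow> ('w \<Rightarrow> real \<Rightarrow> 'a \<Rightarrow> 'a) \<Rightarrow> bool" where
  "injective_system M U \<longleftrightarrow> (AE \<omega> in M. inj (U \<omega> 1))"

definition compact_system ::
  "'w measure \<Rightarrow> ('w \<Rightarrow> real \<Rightarrow> 'a::real_normed_vector \<Rightarrow> 'a) \<Rightarrow> bool" where
  "compact_system M U \<longleftrightarrow> (AE \<omega> in M. \<forall>B. bounded B \<longrightarrow> compact (closure (U \<omega> 1 ` B)))"

definition positive_system ::
  "'w measure \<Rightarrow> real set \<Rightarrow> ('w \<Rightarrow> real \<Rightarrow> 'a::real_vector \<Rightarrow> 'a) \<Rightarrow> 'a set \<Rightarrow> bool" where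
  "positive_system M T U C \<longleftrightarrow>
     (\<forall>\<omega>\<in>space M. \<forall>t\<in>nonneg_times T. \<forall>u1 u2. u2 - u1 \<in> C \<longrightarrow> U \<omega> t u2 - U \<omega> t u1 \<in> C)"

definition entire_orbit ::
  "real set \<Rightarrow> (real \<Rightarrow> 'w \<Rightarrow> 'w) \<Rightarrow> ('w \<Rightarrow> real \<Rightarrow> 'a \<Rightarrow> 'a) \<Rightarrow> 'w \<Rightarrow> (real \<Rightarrow> 'a) \<Rightarrow> bool" where
  "entire_orbit T \<theta> U \<omega> v \<longleftrightarrow>
     (\<forall>s\<in>T. \<forall>t\<in>nonneg_times T. v (s + t) = U (\<theta> s \<omega>) t (v s))"


section \<open>The Oseledets decomposition\<close>

text \<open>The dimension \<open>l\<close> is the same for all \<open>\<omega>\<close>.\<close>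

definition measurable_subspaces ::
  "'w measure \<Rightarrow> 'w set \<Rightarrow> ('w \<Rightarrow> 'a::real_normed_vector set) \<Rightarrow> bool" where
  "measurable_subspaces M \<Omega>0 E \<longleftrightarrow>
     (\<exists>l. \<exists>v :: nat \<Rightarrow> 'w \<Rightarrow> 'a.
        (\<forall>j<l. v j \<in> borel_measurable (restrict_space M \<Omega>0)) \<and>
        (\<forall>\<omega>\<in>\<Omega>0. inj_on (\<lambda>j. v j \<omega>) {..<l} \<and> independent ((\<lambda>j. v j \<omega>) ` {..<l}) \<and>
                 span ((\<lambda>j. v j \<omega>) ` {..<l}) = E \<omega>))"

definition closed_finite_codim_subspaces ::
  "'w set \<Rightarrow> ('w \<Rightarrow> 'a::real_normed_vector set) \<Rightarrow> bool" where
  "closed_finite_codim_subspaces \<Omega>0 F \<longleftrightarrow>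
     (\<forall>\<omega>\<in>\<Omega>0. subspace (F \<omega>) \<and> closed (F \<omega>) \<and> finite_codim (F \<omega>))"

definition strongly_measurable_projections ::
  "'w measure \<Rightarrow> 'w set \<Rightarrow> ('w \<Rightarrow> 'a::real_normed_vector set) \<Rightarrow> ('w \<Rightarrow> 'a set) \<Rightarrow> bool" where
  "strongly_measurable_projections M \<Omega>0 E F \<longleftrightarrow>
     (\<forall>u. (\<lambda>\<omega>. projection_onto (F \<omega>) (E \<omega>) u) \<in> borel_measurable (restrict_space M \<Omega>0))"

text \<open>Here the library's \<open>ln 0 = 0\<close> is intended: if \<open>X\<close> has finite dimension, \<open>F\<close> may be
  \<open>{0}\<close>, and the zero projection counts as tempered. Nonzero projections have norm at least \<open>1\<close>.\<close>

definition tempered_projections ::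
  "'w measure \<Rightarrow> real set \<Rightarrow> (real \<Rightarrow> 'w \<Rightarrow> 'w) \<Rightarrow> 'w set \<Rightarrow>
   ('w \<Rightarrow> 'a::real_normed_vector set) \<Rightarrow> ('w \<Rightarrow> 'a set) \<Rightarrow> bool" where
  "tempered_projections M T \<theta> \<Omega>0 E F \<longleftrightarrow>
     (AE \<omega> in M. \<omega> \<in> \<Omega>0 \<longrightarrow>
        (let g = (\<lambda>t. 1 / t * ln (onorm (projection_onto (F (\<theta> t \<omega>)) (E (\<theta> t \<omega>)))))
         in (g \<longlongrightarrow> 0) (at_top_in T) \<and> (g \<longlongrightarrow> 0) (at_bot_in T)))"

text \<open>For \<open>t < 0\<close> and \<open>u \<in> E \<omega>\<close>, the value is the unique preimage of \<open>u\<close> in \<open>E (\<theta> t \<omega>)\<close>.\<close>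

definition two_sided ::
  "(real \<Rightarrow> 'w \<Rightarrow> 'w) \<Rightarrow> ('w \<Rightarrow> real \<Rightarrow> 'a \<Rightarrow> 'a) \<Rightarrow> ('w \<Rightarrow> 'a set) \<Rightarrow> 'w \<Rightarrow> real \<Rightarrow> 'a \<Rightarrow> 'a" where
  "two_sided \<theta> U E \<omega> t u =
     (if 0 \<le> t then U \<omega> t u else (THE v. v \<in> E (\<theta> t \<omega>) \<and> U (\<theta> t \<omega>) (- t) v = u))"

definition full_invariant_set ::
  "'w measure \<Rightarrow> real set \<Rightarrow> (real \<Rightarrow> 'w \<Rightarrow> 'w) \<Rightarrow> 'w set \<Rightarrow> bool" where
  "full_invariant_set M T \<theta> \<Omega>0 \<longleftrightarrow>
     \<Omega>0 \<in> sets M \<and> invariant_set T \<theta> \<Omega>0 \<and> measure M \<Omega>0 = 1"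

text \<open>The requirements common to both cases at a level \<open>i\<close>, for the exponent \<open>r = \<lambda>\<^sub>i\<close>,
  \<open>E = E\<^sub>i\<close>, \<open>E' = E\<^sub>1 \<oplus> \<dots> \<oplus> E\<^sub>i\<close> and \<open>F = F\<^sub>i\<close>.\<close>

definition oseledets_level ::
  "'w measure \<Rightarrow> real set \<Rightarrow> (real \<Rightarrow> 'w \<Rightarrow> 'w) \<Rightarrow>
   ('w \<Rightarrow> real \<Rightarrow> 'a::{banach, second_countable_topology} \<Rightarrow> 'a) \<Rightarrow> 'w set \<Rightarrow>
   real \<Rightarrow> ('w \<Rightarrow> 'a set) \<Rightarrow> ('w \<Rightarrow> 'a set) \<Rightarrow> ('w \<Rightarrow> 'a set) \<Rightarrow> bool" where
  "oseledets_level M T \<theta> U \<Omega>0 r E E' F \<longleftrightarrow>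
     measurable_subspaces M \<Omega>0 E \<and>
     strongly_measurable_projections M \<Omega>0 E' F \<and>
     tempered_projections M T \<theta> \<Omega>0 E' F \<and>
     (\<forall>\<omega>\<in>\<Omega>0.
        (\<forall>t\<in>nonneg_times T. U \<omega> t ` E \<omega> = E (\<theta> t \<omega>)) \<and>
        (\<forall>A\<in>{at_top_in T, at_bot_in T}.
           growth_rate_to A (\<lambda>t. onorm_on (E \<omega>) (two_sided \<theta> U E \<omega> t)) (ereal r) \<and>
           (\<forall>u\<in>E \<omega> - {0}. growth_rate_to A (\<lambda>t. norm (two_sided \<theta> U E \<omega> t u)) (ereal r))) \<and>
        (\<forall>u\<in>(E \<omega> + F \<omega>) - F \<omega>. growth_rate_to (at_top_in T) (\<lambda>t. norm (U \<omega> t u)) (ereal r)))"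

text \<open>Finitely many exponents. The function update places \<open>F\<^sub>\<infinity>\<close> at index \<open>k + 1\<close>, after
  \<open>E\<^sub>1, \<dots>, E\<^sub>k\<close>; the sets \<open>F\<^sub>i\<close> are \<open>E\<^sub>i\<^sub>+\<^sub>1 \<oplus> \<dots> \<oplus> E\<^sub>k \<oplus> F\<^sub>\<infinity>\<close>.\<close>

definition oseledets_finite ::
  "'w measure \<Rightarrow> real set \<Rightarrow> (real \<Rightarrow> 'w \<Rightarrow> 'w) \<Rightarrow>
   ('w \<Rightarrow> real \<Rightarrow> 'a::{banach, second_countable_topology} \<Rightarrow> 'a) \<Rightarrow> 'w set \<Rightarrow>
   nat \<Rightarrow> (nat \<Rightarrow> real) \<Rightarrow> (nat \<Rightarrow> 'w \<Rightarrow> 'a set) \<Rightarrow> ('w \<Rightarrow> 'a set) \<Rightarrow> bool" where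
  "oseledets_finite M T \<theta> U \<Omega>0 k lam E Finf \<longleftrightarrow>
     full_invariant_set M T \<theta> \<Omega>0 \<and>
     1 \<le> k \<and> (\<forall>i\<in>{1..<k}. lam (Suc i) < lam i) \<and>
     closed_finite_codim_subspaces \<Omega>0 Finf \<and>
     (\<forall>\<omega>\<in>\<Omega>0.
        direct_sum {1..Suc k} ((\<lambda>j. E j \<omega>)(Suc k := Finf \<omega>)) UNIV \<and>
        (\<forall>t\<in>nonneg_times T. U \<omega> t ` Finf \<omega> \<subseteq> Finf (\<theta> t \<omega>)) \<and>
        growth_rate_to (at_top_in T) (\<lambda>t. onorm_on (Finf \<omega>) (U \<omega> t)) (-\<infinity>)) \<and>
     (\<forall>i\<in>{1..k}. oseledets_level M T \<theta> U \<Omega>0 (lam i) (E i)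
        (\<lambda>\<omega>. \<Sum>j\<in>{1..i}. E j \<omega>) (\<lambda>\<omega>. (\<Sum>j\<in>{Suc i..k}. E j \<omega>) + Finf \<omega>))"

text \<open>Infinitely many exponents; index \<open>0\<close> is unused.\<close>

definition oseledets_infinite ::
  "'w measure \<Rightarrow> real set \<Rightarrow> (real \<Rightarrow> 'w \<Rightarrow> 'w) \<Rightarrow>
   ('w \<Rightarrow> real \<Rightarrow> 'a::{banach, second_countable_topology} \<Rightarrow> 'a) \<Rightarrow> 'w set \<Rightarrow>
   (nat \<Rightarrow> real) \<Rightarrow> (nat \<Rightarrow> 'w \<Rightarrow> 'a set) \<Rightarrow> (nat \<Rightarrow> 'w \<Rightarrow> 'a set) \<Rightarrow> bool" where
  "oseledets_infinite M T \<theta> U \<Omega>0 lam E F \<longleftrightarrow>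
     full_invariant_set M T \<theta> \<Omega>0 \<and>
     (\<forall>i\<ge>1. lam (Suc i) < lam i) \<and> filterlim lam at_bot sequentially \<and>
     (\<forall>i\<ge>1.
        closed_finite_codim_subspaces \<Omega>0 (F i) \<and>
        (\<forall>\<omega>\<in>\<Omega>0.
           direct_sum {1..Suc i} ((\<lambda>j. E j \<omega>)(Suc i := F i \<omega>)) UNIV \<and>
           direct_sum2 (E (Suc i) \<omega>) (F (Suc i) \<omega>) (F i \<omega>) \<and>
           (\<forall>t\<in>nonneg_times T. U \<omega> t ` F i \<omega> \<subseteq> F i (\<theta> t \<omega>)) \<and>
           growth_rate_to (at_top_in T) (\<lambda>t. onorm_on (F i \<omega>) (U \<omega> t)) (ereal (lam (Suc i)))) \<and>
        oseledets_level M T \<theta> U \<Omega>0 (lam i) (E i) (\<lambda>\<omega>. \<Sum>j\<in>{1..i}. E j \<omega>) (F i))"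

definition oseledets_decomposition ::
  "'w measure \<Rightarrow> real set \<Rightarrow> (real \<Rightarrow> 'w \<Rightarrow> 'w) \<Rightarrow>
   ('w \<Rightarrow> real \<Rightarrow> 'a::{banach, second_countable_topology} \<Rightarrow> 'a) \<Rightarrow> 'w set \<Rightarrow>
   (nat \<Rightarrow> 'w \<Rightarrow> 'a set) \<Rightarrow> bool" where
  "oseledets_decomposition M T \<theta> U \<Omega>0 E \<longleftrightarrow>
     (\<exists>k lam Finf. oseledets_finite M T \<theta> U \<Omega>0 k lam E Finf) \<or>
     (\<exists>lam F. oseledets_infinite M T \<theta> U \<Omega>0 lam E F)"

text \<open>For \<open>t \<ge> 0\<close>, positivity makes \<open>\<theta> t\<close> map this set into itself, but on a null set of orbits \<open>\<theta> (- t)\<close>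
  may lead out of it, and no entire orbit inside the cone exists there. Since \<open>\<Omega>\<^sub>0\<close> is only given up
  to null invariant sets, entire orbits are claimed for a suitable choice of \<open>\<Omega>\<^sub>0\<close>.\<close>

definition positive_principal_set :: "'w set \<Rightarrow> (nat \<Rightarrow> 'w \<Rightarrow> 'a::zero set) \<Rightarrow> 'a set \<Rightarrow> 'w set" where
  "positive_principal_set \<Omega>0 E C = {\<omega>\<in>\<Omega>0. {0} \<subset> E 1 \<omega> \<inter> C}"

end

theory Submission
  imports Defs
begin

text \<open>Write \<open>E = E\<^sub>1\<close> and let \<open>F\<close> be its invariant complement, \<open>F\<^sub>1\<close>. Vectors of \<open>F\<close> grow at a
  strictly smaller exponential rate than nonzero vectors of \<open>E\<close>, so under the cocycle every vector
  outside \<open>F \<omega>\<close> turns towards \<open>E\<close>. Since \<open>F \<omega>\<close> is a proper closed subspace and the cone \<open>C\<close> is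
  total, there is a vector of \<open>C\<close> outside \<open>F \<omega>\<close>, and positivity keeps its orbit in \<open>C\<close>. Hence the
  angle between \<open>E\<close> and \<open>C\<close> at \<open>\<theta> n \<omega>\<close> tends to \<open>0\<close> as \<open>n \<rightarrow> \<infinity>\<close>
  (\<open>eventually_nearly_positive\<close>).

  This convergence says nothing about a single fibre, but the flow preserves the measure: a
  measurable set that is eventually entered for good along almost every orbit has measure one
  (\<open>eventually_in_imp_measure_1\<close>). Thus for every \<open>\<epsilon> > 0\<close> almost every fibre has angle less than
  \<open>\<epsilon>\<close>, and so almost every angle is zero. Because the unit sphere of the finite-dimensional
  \<open>E \<omega>\<close> is compact and \<open>C\<close> is closed, a zero angle means that \<open>E \<omega>\<close> and \<open>C\<close> share a nonzero vector
  (\<open>positive_set_eq_Inter\<close>).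

  For the entire orbits, shrink \<open>\<Omega>\<^sub>0\<close> to the points whose whole past consists of such fibres. The
  images in \<open>E \<omega>\<close> of the cones \<open>E \<inter> C\<close> over \<open>\<theta> (- n) \<omega>\<close> decrease with \<open>n\<close>, and compactness
  yields a nonzero vector in all of them (\<open>exists_past_positive_vector\<close>). The cocycle is injective
  on \<open>E\<close>, because the orbit of a vector that it kills would not have a finite growth rate; hence the
  preimages of that vector in the past cones fit together to one orbit
  (\<open>exists_positive_entire_orbit\<close>).

  The locale \<open>dominated_splitting\<close> collects what this argument uses of an Oseledets decomposition.
  Both the finite and the infinite case provide it.\<close>

section \<open>Finite-dimensional subspaces of a normed space\<close>

lemma subspace_set_plus:
  assumes "subspace A" "subspace B"
  shows "subspace (A + B)"
proof -
  have "A + B = {x + y |x y. x \<in> A \<and> y \<in> B}" by (auto simp: set_plus_def)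
  then show ?thesis using subspace_sums[OF assms] by simp
qed

text \<open>For \<open>k \<noteq> 0\<close>, dividing by \<open>k\<close> exhibits a point of \<open>G\<close> at distance \<open>norm x / \<bar>k\<bar>\<close> from \<open>b\<close>.\<close>

lemma coefficient_bound:
  fixes G :: "'a::real_normed_vector set"
  assumes G: "subspace G" and x: "x - k *\<^sub>R b \<in> G"
  shows "\<bar>k\<bar> * infdist b G \<le> norm x"
proof (cases "k = 0")
  case False
  have "(- 1 / k) *\<^sub>R (x - k *\<^sub>R b) \<in> G"
    using G x subspace_scale by blast
  also have "(- 1 / k) *\<^sub>R (x - k *\<^sub>R b) = b - (1 / k) *\<^sub>R x"
    using False by (simp add: algebra_simps)
  finally have "infdist b G \<le> dist b (b - (1 / k) *\<^sub>R x)"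
    by (rule infdist_le)
  also have "\<dots> = norm x / \<bar>k\<bar>"
    by (simp add: dist_norm)
  finally show ?thesis
    using False by (simp add: field_simps)
qed simp

text \<open>By the bound above, the coefficients of \<open>b\<close> along a convergent sequence form a Cauchy
  sequence, and their limit splits the limit of the sequence.\<close>

lemma closed_subspace_add_line:
  fixes G :: "'a::real_normed_vector set"
  assumes G: "subspace G" "closed G"
  shows "closed {x. \<exists>k. x - k *\<^sub>R b \<in> G}"
proof (cases "b \<in> G")
  case True
  have "x \<in> G" if "x - k *\<^sub>R b \<in> G" for x k
    using subspace_add[OF G(1) that subspace_scale[OF G(1) True, of k]] by simp
  then have "{x. \<exists>k. x - k *\<^sub>R b \<in> G} = G"
    by (auto intro: exI[of _ 0])
  with G show ?thesis by simp
next
  case False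
  define d where "d = infdist b G"
  have d: "d > 0"
    unfolding d_def using infdist_pos_not_in_closed[OF G(2) _ False] subspace_0[OF G(1)] by blast
  show ?thesis
    unfolding closed_sequential_limits
  proof safe
    fix x l assume "\<forall>n. x n \<in> {x. \<exists>k. x - k *\<^sub>R b \<in> G}" and lim: "x \<longlonglongrightarrow> l"
    then obtain k where k: "\<And>n. x n - k n *\<^sub>R b \<in> G"
      by simp metis
    have bound: "\<bar>k m - k n\<bar> * d \<le> norm (x m - x n)" for m n
      unfolding d_def
      by (rule coefficient_bound[OF G(1)])
        (use subspace_diff[OF G(1) k[of m] k[of n]] in \<open>simp add: algebra_simps\<close>)
    have "Cauchy k"
    proof (rule CauchyI)
      fix e :: real assume "0 < e"
      then obtain N where N: "\<And>m n. m \<ge> N \<Longrightarrow> n \<ge> N \<Longrightarrow> norm (x m - x n) < e * d"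
        using CauchyD[OF LIMSEQ_imp_Cauchy[OF lim], of "e * d"] d by auto
      have "norm (k m - k n) < e" if "m \<ge> N" "n \<ge> N" for m n
      proof -
        have "\<bar>k m - k n\<bar> * d < e * d"
          using bound[of m n] N[OF that] by simp
        with d show ?thesis by simp
      qed
      then show "\<exists>N. \<forall>m\<ge>N. \<forall>n\<ge>N. norm (k m - k n) < e" by blast
    qed
    then obtain a where a: "k \<longlonglongrightarrow> a"
      using Cauchy_convergent convergent_def by blast
    have "(\<lambda>n. x n - k n *\<^sub>R b) \<longlonglongrightarrow> l - a *\<^sub>R b"
      by (intro tendsto_intros lim a)
    then have "l - a *\<^sub>R b \<in> G"
      by (rule closed_sequentially[OF G(2) k])
    then show "\<exists>k. l - k *\<^sub>R b \<in> G" by blast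
  qed
qed

lemma closed_subspace_add_span:
  fixes G :: "'a::real_normed_vector set"
  assumes "finite B" "subspace G" "closed G"
  shows "closed (G + span B)"
  using assms(1)
proof induction
  case empty
  have "G + span {} = G" by (auto simp: set_plus_def)
  with assms show ?case by simp
next
  case (insert b B)
  have "G + span (insert b B) = {x. \<exists>k. x - k *\<^sub>R b \<in> G + span B}"
  proof (safe elim!: set_plus_elim)
    fix g y assume g: "g \<in> G" and "y \<in> span (insert b B)"
    then obtain k where "y - k *\<^sub>R b \<in> span B"
      by (auto simp: span_insert)
    then have "g + y - k *\<^sub>R b \<in> G + span B"
      using set_plus_intro[OF g] by (metis add_diff_eq)
    then show "\<exists>k. g + y - k *\<^sub>R b \<in> G + span B" by blast
  next
    fix x k g y assume x: "x - k *\<^sub>R b = g + y" and g: "g \<in> G" and y: "y \<in> span B"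
    have "y + k *\<^sub>R b \<in> span (insert b B)"
      using y by (auto simp: span_insert intro!: exI[of _ k])
    moreover have "x = g + (y + k *\<^sub>R b)"
      using x by (simp add: algebra_simps)
    ultimately show "x \<in> G + span (insert b B)"
      using g set_plus_intro by blast
  qed
  then show ?case
    using closed_subspace_add_line[OF subspace_set_plus[OF assms(2) subspace_span] insert.IH]
    by simp
qed

lemma closed_span_finite:
  fixes B :: "'a::real_normed_vector set"
  assumes "finite B"
  shows "closed (span B)"
proof -
  have "{0} + span B = span B" by (auto simp: set_plus_def)
  then show ?thesis
    using closed_subspace_add_span[OF assms subspace_single_0] by simp
qed

text \<open>Adding one vector \<open>b\<close> at distance \<open>d > 0\<close> from the span: in a vector of norm at most \<open>r\<close> the
  coefficient of \<open>b\<close> is at most \<open>r / d\<close>, so the ball lies in the continuous image of the product of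
  an interval and a larger ball of the smaller span.\<close>

lemma compact_span_cball:
  fixes B :: "'a::real_normed_vector set"
  assumes "finite B"
  shows "compact (span B \<inter> cball 0 r)"
  using assms
proof (induction arbitrary: r)
  case empty
  have "finite (span {} \<inter> cball (0::'a) r)" by (auto intro: finite_subset[of _ "{0}"])
  then show ?case by (rule finite_imp_compact)
next
  case (insert b B)
  show ?case
  proof (cases "b \<in> span B")
    case True
    then show ?thesis using insert.IH by (simp add: span_redundant)
  next
    case False
    define d where "d = infdist b (span B)"
    have d: "d > 0"
      unfolding d_def
      using infdist_pos_not_in_closed[OF closed_span_finite[OF insert.hyps(1)] _ False] span_0
      by blast
    define R where "R = r + r / d * norm b"
    define K where "K = (\<lambda>(a, y). y + a *\<^sub>R b) ` ({-r / d..r / d} \<times> (span B \<inter> cball 0 R))"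
    have "compact K"
      unfolding K_def split_beta
      by (intro compact_continuous_image compact_Times insert.IH compact_Icc continuous_intros)
    moreover have "closed (span (insert b B) \<inter> cball 0 r)"
      using closed_span_finite[of "insert b B"] insert.hyps(1) by (intro closed_Int) auto
    moreover have "span (insert b B) \<inter> cball 0 r \<subseteq> K"
    proof
      fix x assume x: "x \<in> span (insert b B) \<inter> cball 0 r"
      then obtain k where k: "x - k *\<^sub>R b \<in> span B"
        by (auto simp: span_insert)
      have "\<bar>k\<bar> * d \<le> r"
        using coefficient_bound[OF subspace_span k] x by (simp add: d_def)
      then have kr: "\<bar>k\<bar> \<le> r / d"
        using d by (simp add: field_simps)
      have "norm (x - k *\<^sub>R b) \<le> norm x + \<bar>k\<bar> * norm b"
        using norm_triangle_ineq4[of x "k *\<^sub>R b"] by simp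
      also have "\<dots> \<le> R"
        unfolding R_def using x kr by (intro add_mono mult_right_mono) auto
      finally have "x - k *\<^sub>R b \<in> span B \<inter> cball 0 R"
        using k by simp
      then show "x \<in> K"
        unfolding K_def using kr by (intro image_eqI[of _ _ "(k, x - k *\<^sub>R b)"]) auto
    qed
    ultimately show ?thesis
      by (metis compact_Int_closed inf.absorb_iff2 inf_commute)
  qed
qed

lemma compact_span_sphere:
  fixes B :: "'a::real_normed_vector set"
  assumes "finite B"
  shows "compact (span B \<inter> sphere 0 1)"
proof -
  have "span B \<inter> sphere 0 1 = (span B \<inter> cball 0 1) \<inter> sphere 0 1" by auto
  moreover have "closed (sphere (0::'a) 1)"
    unfolding sphere_def by (intro closed_Collect_eq continuous_intros)
  ultimately show ?thesis
    using compact_Int_closed[OF compact_span_cball[OF assms]] by simp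
qed

lemma span_image_eq_range:
  fixes v :: "nat \<Rightarrow> 'a::real_vector"
  assumes "inj_on v {..<l}"
  shows "span (v ` {..<l}) = range (\<lambda>c. \<Sum>j<l. c j *\<^sub>R v j)"
proof (intro equalityI subsetI)
  fix x assume "x \<in> span (v ` {..<l})"
  then obtain u where "x = (\<Sum>w\<in>v ` {..<l}. u w *\<^sub>R w)"
    by (auto simp: span_finite)
  then show "x \<in> range (\<lambda>c. \<Sum>j<l. c j *\<^sub>R v j)"
    by (auto simp: sum.reindex[OF assms] intro!: image_eqI[of _ _ "u \<circ> v"])
next
  fix x assume "x \<in> range (\<lambda>c. \<Sum>j<l. c j *\<^sub>R v j)"
  then show "x \<in> span (v ` {..<l})"
    by (auto intro: span_sum span_scale span_base)
qed

lemma compact_nested_Inter: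
  fixes K :: "nat \<Rightarrow> 'a::t2_space set"
  assumes "\<And>n. compact (K n)" "\<And>n. K n \<noteq> {}" "\<And>n. K (Suc n) \<subseteq> K n"
  shows "(\<Inter>n. K n) \<noteq> {}"
proof -
  have mono: "K n \<subseteq> K m" if "m \<le> n" for m n
    by (rule lift_Suc_antimono_le[of K, OF assms(3) that])
  have "K 0 \<inter> (\<Inter>n\<in>UNIV. K n) \<noteq> {}"
  proof (rule compact_imp_fip_image)
    fix I :: "nat set" assume I: "finite I"
    have "K (Max (insert 0 I)) \<subseteq> K 0 \<inter> (\<Inter>n\<in>I. K n)"
      using I by (intro Int_greatest INT_greatest mono) auto
    then show "K 0 \<inter> (\<Inter>n\<in>I. K n) \<noteq> {}" using assms(2) by blast
  qed (auto intro: assms(1) compact_imp_closed)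
  then show ?thesis by blast
qed

text \<open>The decompositions are given as direct sums of all their members; the domination argument
  needs only one member against the sum of the others.\<close>

lemma direct_sum_split:
  assumes sum: "direct_sum I V UNIV" and I: "finite I" "i \<in> I"
    and sub: "\<And>j. j \<in> I \<Longrightarrow> subspace (V j)"
  shows "V i + (\<Sum>j\<in>I - {i}. V j) = UNIV" and "V i \<inter> (\<Sum>j\<in>I - {i}. V j) = {0}"
proof -
  show "V i + (\<Sum>j\<in>I - {i}. V j) = UNIV"
    using sum I by (simp add: direct_sum_def sum.remove[symmetric])
  have "x = 0" if x: "x \<in> V i" "x \<in> (\<Sum>j\<in>I - {i}. V j)" for x
  proof -
    obtain s where s: "x = sum s (I - {i})" "\<And>j. j \<in> I - {i} \<Longrightarrow> s j \<in> V j"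
      using x(2) I by (auto simp: set_sum_alt)
    define y where "y = s(i := - x)"
    have "\<forall>j\<in>I. y j \<in> V j"
      using s(2) x(1) I sub by (auto simp: y_def subspace_neg)
    moreover have "sum y I = 0"
    proof -
      have "sum y I = y i + sum y (I - {i})" by (rule sum.remove[OF I])
      also have "sum y (I - {i}) = x" unfolding s(1) by (rule sum.cong) (auto simp: y_def)
      finally show ?thesis by (simp add: y_def)
    qed
    ultimately have "y i = 0"
      using sum I unfolding direct_sum_def by blast
    then show ?thesis by (simp add: y_def)
  qed
  moreover have "0 \<in> (\<Sum>j\<in>I - {i}. V j)"
    using I sub by (auto simp: set_sum_alt subspace_0 intro!: exI[of _ "\<lambda>_. 0"])
  ultimately show "V i \<inter> (\<Sum>j\<in>I - {i}. V j) = {0}"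
    using subspace_0[OF sub[OF I(2)]] by blast
qed

text \<open>In the case of finitely many exponents closedness is given for \<open>F\<^sub>\<infinity>\<close> alone, while totality of
  the cone has to be played against the larger \<open>F\<^sub>1\<close>.\<close>

lemma closed_subspace_plus_finite_sum:
  fixes G :: "'a::real_normed_vector set"
  assumes "finite J" and G: "subspace G" "closed G"
    and V: "\<And>j. j \<in> J \<Longrightarrow> \<exists>B. finite B \<and> V j = span B"
  shows "subspace ((\<Sum>j\<in>J. V j) + G) \<and> closed ((\<Sum>j\<in>J. V j) + G)"
  using assms(1) V
proof (induction J)
  case empty
  then show ?case using G by simp
next
  case (insert j J)
  then obtain B where B: "finite B" "V j = span B" by auto
  have "(\<Sum>i\<in>insert j J. V i) + G = ((\<Sum>i\<in>J. V i) + G) + span B"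
    using insert.hyps B by (simp add: ac_simps)
  then show ?case
    using insert B closed_subspace_add_span[OF B(1)] subspace_set_plus[OF _ subspace_span] by auto
qed

section \<open>Exponential growth rates\<close>

lemma eventually_at_top_in_pos: "eventually (\<lambda>t. 0 < t) (at_top_in T)"
  unfolding at_top_in_def by (rule filter_leD[OF inf_le1 eventually_gt_at_top])

lemma growth_rate_to_upper:
  assumes "growth_rate_to (at_top_in T) g r" and "r < ereal b"
  shows "eventually (\<lambda>t. g t \<le> exp (b * t)) (at_top_in T)"
proof -
  have "eventually (\<lambda>t. ereal (1 / t) * ln_ext (g t) < ereal b) (at_top_in T)"
    using assms unfolding growth_rate_to_def by (rule order_tendstoD(2))
  with eventually_at_top_in_pos show ?thesis
  proof eventually_elim
    case (elim t)
    show ?case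
    proof (cases "g t \<le> 0")
      case True
      then show ?thesis using exp_ge_zero order_trans by blast
    next
      case False
      with elim have "ln (g t) < b * t" by (simp add: ln_ext_def field_simps)
      with False show ?thesis
        by (metis exp_less_cancel_iff exp_ln less_eq_real_def not_le)
    qed
  qed
qed

lemma growth_rate_to_lower:
  assumes "growth_rate_to (at_top_in T) g r" and "ereal b < r"
  shows "eventually (\<lambda>t. exp (b * t) \<le> g t) (at_top_in T)"
proof -
  have "eventually (\<lambda>t. ereal b < ereal (1 / t) * ln_ext (g t)) (at_top_in T)"
    using assms unfolding growth_rate_to_def by (rule order_tendstoD(1))
  with eventually_at_top_in_pos show ?thesis
  proof eventually_elim
    case (elim t)
    then have pos: "g t > 0" by (auto simp: ln_ext_def split: if_splits)
    with elim have "b * t < ln (g t)" by (simp add: ln_ext_def field_simps)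
    with pos show ?case
      by (metis exp_less_cancel_iff exp_ln less_eq_real_def)
  qed
qed

text \<open>Two numbers \<open>a < b\<close> strictly between the rates give \<open>g t \<le> exp (a * t)\<close> and
  \<open>h t \<ge> exp (b * t)\<close> eventually. The function \<open>f\<close> is there because the growth on \<open>F\<^sub>1\<close> or
  \<open>F\<^sub>\<infinity>\<close> is known in the operator norm only, which bounds each orbit up to the factor \<open>c\<close>.\<close>

lemma growth_rate_ratio_tendsto_0:
  assumes g: "growth_rate_to (at_top_in T) g r" and h: "growth_rate_to (at_top_in T) h s"
    and "r < s" and "0 \<le> c"
    and f: "eventually (\<lambda>t. 0 \<le> f t \<and> f t \<le> c * g t) (at_top_in T)"
  shows "((\<lambda>t. f t / h t) \<longlongrightarrow> 0) (at_top_in T)"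
proof -
  obtain a where a: "r < ereal a" "ereal a < s"
    using ereal_dense2[OF \<open>r < s\<close>] by auto
  obtain b where b: "ereal a < ereal b" "ereal b < s"
    using ereal_dense2[OF a(2)] by auto
  have "((\<lambda>t. exp ((a - b) * t)) \<longlongrightarrow> 0) at_top"
    using b by (intro filterlim_compose[OF exp_at_bot]
        filterlim_tendsto_neg_mult_at_bot[OF tendsto_const] filterlim_ident) auto
  then have "((\<lambda>t. exp ((a - b) * t)) \<longlongrightarrow> 0) (at_top_in T)"
    unfolding at_top_in_def by (rule tendsto_mono[OF inf_le1])
  then have lim: "((\<lambda>t. c * exp ((a - b) * t)) \<longlongrightarrow> 0) (at_top_in T)"
    by (rule tendsto_mult_right_zero)
  have "eventually (\<lambda>t. norm (f t / h t) \<le> c * exp ((a - b) * t)) (at_top_in T)"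
    using growth_rate_to_upper[OF g a(1)] growth_rate_to_lower[OF h b(2)] f
  proof eventually_elim
    case (elim t)
    have "f t \<le> c * exp (a * t)"
      using elim mult_left_mono[OF _ \<open>0 \<le> c\<close>] by (meson order_trans)
    then have "f t / h t \<le> c * exp (a * t) / exp (b * t)"
      using elim \<open>0 \<le> c\<close> by (intro frac_le) auto
    moreover have "0 \<le> f t / h t"
      using elim by (meson divide_nonneg_nonneg exp_ge_zero order_trans)
    ultimately show ?case by (simp add: exp_diff algebra_simps)
  qed
  then show ?thesis by (rule Lim_null_comparison[OF _ lim])
qed

lemma norm_le_onorm_on:
  assumes f: "bounded_linear f" and x: "x \<in> E"
  shows "norm (f x) \<le> onorm_on E f * norm x"
proof -
  interpret bounded_linear f by fact
  have "bdd_above ((\<lambda>x. norm (f x) / norm x) ` E)"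
    using le_onorm[OF f] by (intro bdd_aboveI2[of _ _ "onorm f"])
  then have "norm (f x) / norm x \<le> onorm_on E f"
    unfolding onorm_on_def using x by (rule cSUP_upper2) auto
  then show ?thesis
    by (cases "x = 0") (auto simp: field_simps zero)
qed


section \<open>Recurrence under a measure-preserving flow\<close>

context metric_dynamical_system
begin

lemma of_nat_time: "real n \<in> T" "- real n \<in> T" "real n \<in> nonneg_times T"
  using time_set by (auto simp: nonneg_times_def)

lemma time_add: "s \<in> T \<Longrightarrow> t \<in> T \<Longrightarrow> s + t \<in> T"
  using time_set by auto

lemma time_uminus: "t \<in> T \<Longrightarrow> - t \<in> T"
  using time_set by auto

lemma time_diff: "s \<in> T \<Longrightarrow> t \<in> T \<Longrightarrow> s - t \<in> T"
  using time_set by auto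

lemma flow_time_measurable:
  assumes "t \<in> T"
  shows "\<theta> t \<in> M \<rightarrow>\<^sub>M M"
proof -
  have "(\<lambda>\<omega>. (t, \<omega>)) \<in> M \<rightarrow>\<^sub>M restrict_space borel T \<Otimes>\<^sub>M M"
    using assms by (intro measurable_Pair) (auto simp: space_restrict_space)
  from measurable_compose[OF this flow_measurable] show ?thesis by simp
qed

lemma measure_flow_vimage:
  assumes "t \<in> T" "A \<in> sets M"
  shows "measure M (\<theta> t -` A \<inter> space M) = measure M A"
  using measure_distr[OF flow_time_measurable[OF assms(1)] assms(2)] flow_preserves[OF assms(1)]
  by simp

lemma sequence_at_top_in: "filterlim real (at_top_in T) sequentially"
  unfolding at_top_in_def filterlim_inf filterlim_principal
  using filterlim_real_sequentially of_nat_time(1) by simp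

lemma at_top_in_nontrivial: "at_top_in T \<noteq> bot"
proof
  assume "at_top_in T = bot"
  then have "filterlim real bot sequentially" using sequence_at_top_in by simp
  then have "eventually (\<lambda>_. False) sequentially"
    unfolding filterlim_iff by (elim allE[of _ "\<lambda>_. False"]) simp
  then show False by simp
qed

text \<open>The sets of points whose orbit stays in \<open>A\<close> from time \<open>n\<close> on exhaust \<open>\<Omega>\<close>, and each is
  contained in the preimage of \<open>A\<close> under the time-\<open>n\<close> map, which has the measure of \<open>A\<close>.\<close>

lemma eventually_in_imp_measure_1:
  assumes A: "A \<in> sets M" and \<Omega>: "\<Omega> \<in> sets M" "measure M \<Omega> = 1"
    and ev: "\<And>\<omega>. \<omega> \<in> \<Omega> \<Longrightarrow> eventually (\<lambda>n. \<theta> (real n) \<omega> \<in> A) sequentially"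
  shows "measure M A = 1"
proof -
  define V where "V n = \<theta> (real n) -` A \<inter> space M" for n
  define B where "B n = (\<Inter>m\<in>{n..}. V m)" for n
  have V: "V n \<in> sets M" "measure M (V n) = measure M A" for n
    unfolding V_def using A measurable_sets[OF flow_time_measurable[OF of_nat_time(1)] A]
    by (auto intro: measure_flow_vimage of_nat_time)
  have B: "B n \<in> sets M" for n
    unfolding B_def using V by (intro sets.countable_INT') auto
  have "incseq B"
    by (rule incseq_SucI) (auto simp: B_def)
  then have "(\<lambda>n. measure M (B n)) \<longlonglongrightarrow> measure M (\<Union>n. B n)"
    using B by (intro finite_Lim_measure_incseq) auto
  moreover have "measure M (B n) \<le> measure M A" for n
    using finite_measure_mono[of "B n" "V n"] V by (auto simp: B_def)
  ultimately have "measure M (\<Union>n. B n) \<le> measure M A"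
    using LIMSEQ_le_const2 by blast
  moreover have "\<Omega> \<subseteq> (\<Union>n. B n)"
    using ev sets.sets_into_space[OF \<Omega>(1)] by (fastforce simp: B_def V_def eventually_sequentially)
  then have "measure M \<Omega> \<le> measure M (\<Union>n. B n)"
    using B by (intro finite_measure_mono) auto
  ultimately show ?thesis
    using \<Omega>(2) prob_le_1[of A] by linarith
qed

end

section \<open>Invariant splittings with a dominating finite-dimensional part\<close>

lemma measurable_subspaces_finite_span:
  fixes M :: "'w measure" and E :: "'w \<Rightarrow> 'a::real_normed_vector set"
  assumes "measurable_subspaces M \<Omega> E" "\<omega> \<in> \<Omega>"
  shows "\<exists>B. finite B \<and> E \<omega> = span B"
proof -
  obtain l and v :: "nat \<Rightarrow> 'w \<Rightarrow> 'a" where "span ((\<lambda>j. v j \<omega>) ` {..<l}) = E \<omega>"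
    using assms unfolding measurable_subspaces_def by blast
  then show ?thesis
    by (intro exI[of _ "(\<lambda>j. v j \<omega>) ` {..<l}"]) auto
qed

locale dominated_splitting = linear_skew_product M T \<theta> U
  for M :: "'w measure" and T :: "real set" and \<theta> :: "real \<Rightarrow> 'w \<Rightarrow> 'w"
    and U :: "'w \<Rightarrow> real \<Rightarrow> 'a::{banach, second_countable_topology} \<Rightarrow> 'a" +
  fixes \<Omega> :: "'w set" and E F :: "'w \<Rightarrow> 'a set"
  assumes full_invariant: "full_invariant_set M T \<theta> \<Omega>"
    and measurable_E: "measurable_subspaces M \<Omega> E"
    and cocycle_image_E:
      "\<And>\<omega> t. \<omega> \<in> \<Omega> \<Longrightarrow> t \<in> nonneg_times T \<Longrightarrow> U \<omega> t ` E \<omega> = E (\<theta> t \<omega>)"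
    and cocycle_kernel_E:
      "\<And>\<omega> t e. \<omega> \<in> \<Omega> \<Longrightarrow> t \<in> nonneg_times T \<Longrightarrow> e \<in> E \<omega> \<Longrightarrow> U \<omega> t e = 0 \<Longrightarrow> e = 0"
    and E_nontrivial: "\<And>\<omega>. \<omega> \<in> \<Omega> \<Longrightarrow> E \<omega> \<noteq> {0}"
    and closed_F: "\<And>\<omega>. \<omega> \<in> \<Omega> \<Longrightarrow> closed (F \<omega>)"
    and subspace_F: "\<And>\<omega>. \<omega> \<in> \<Omega> \<Longrightarrow> subspace (F \<omega>)"
    and E_plus_F: "\<And>\<omega>. \<omega> \<in> \<Omega> \<Longrightarrow> E \<omega> + F \<omega> = UNIV"
    and E_inter_F: "\<And>\<omega>. \<omega> \<in> \<Omega> \<Longrightarrow> E \<omega> \<inter> F \<omega> = {0}"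
    and domination:
      "\<And>\<omega> e f. \<omega> \<in> \<Omega> \<Longrightarrow> e \<in> E \<omega> \<Longrightarrow> e \<noteq> 0 \<Longrightarrow> f \<in> F \<omega> \<Longrightarrow>
         (\<lambda>n. norm (U \<omega> (real n) f) / norm (U \<omega> (real n) e)) \<longlonglongrightarrow> 0"
begin

lemma \<Omega>_sets: "\<Omega> \<in> sets M" and \<Omega>_measure: "measure M \<Omega> = 1"
  using full_invariant by (auto simp: full_invariant_set_def)

lemma \<Omega>_space: "\<omega> \<in> \<Omega> \<Longrightarrow> \<omega> \<in> space M"
  using sets.sets_into_space[OF \<Omega>_sets] by blast

lemma flow_in_\<Omega>: "\<omega> \<in> \<Omega> \<Longrightarrow> t \<in> T \<Longrightarrow> \<theta> t \<omega> \<in> \<Omega>"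
  using full_invariant by (auto simp: full_invariant_set_def invariant_set_def)

lemma E_finite_span:
  assumes "\<omega> \<in> \<Omega>"
  obtains B where "finite B" "E \<omega> = span B"
  using measurable_subspaces_finite_span[OF measurable_E assms] by blast

lemma subspace_E: "\<omega> \<in> \<Omega> \<Longrightarrow> subspace (E \<omega>)"
  by (erule E_finite_span) simp

lemma bounded_linear_U: "\<omega> \<in> \<Omega> \<Longrightarrow> t \<in> nonneg_times T \<Longrightarrow> bounded_linear (U \<omega> t)"
  by (simp add: cocycle_linear \<Omega>_space)

lemma cocycle_inj_on_E:
  assumes "\<omega> \<in> \<Omega>" "t \<in> nonneg_times T"
  shows "inj_on (U \<omega> t) (E \<omega>)"
proof (rule inj_onI)
  interpret bounded_linear "U \<omega> t" using assms by (rule bounded_linear_U)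
  fix x y assume "x \<in> E \<omega>" "y \<in> E \<omega>" "U \<omega> t x = U \<omega> t y"
  then show "x = y"
    using cocycle_kernel_E[OF assms, of "x - y"] subspace_diff[OF subspace_E[OF assms(1)]]
    by (simp add: diff)
qed

end

section \<open>Positivity of the dominating part\<close>

locale positive_dominated_splitting = dominated_splitting M T \<theta> U \<Omega> E F
  for M :: "'w measure" and T :: "real set" and \<theta> :: "real \<Rightarrow> 'w \<Rightarrow> 'w"
    and U :: "'w \<Rightarrow> real \<Rightarrow> 'a::{banach, second_countable_topology} \<Rightarrow> 'a"
    and \<Omega> :: "'w set" and E F :: "'w \<Rightarrow> 'a set" +
  fixes C :: "'a set"
  assumes order_cone: "order_cone C"
    and total_cone: "total_cone C"
    and positive: "positive_system M T U C"
begin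

lemma C_closed: "closed C" and C_nonempty: "C \<noteq> {}" and C_0: "0 \<in> C"
  and C_scaleR: "x \<in> C \<Longrightarrow> 0 \<le> c \<Longrightarrow> c *\<^sub>R x \<in> C"
  using order_cone by (auto simp: order_cone_def convex_cone_iff)

lemma U_cone:
  assumes "\<omega> \<in> \<Omega>" "t \<in> nonneg_times T" "x \<in> C"
  shows "U \<omega> t x \<in> C"
proof -
  interpret bounded_linear "U \<omega> t" using assms(1,2) by (rule bounded_linear_U)
  show ?thesis
    using positive[unfolded positive_system_def, rule_format, OF \<Omega>_space[OF assms(1)] assms(2), of x 0]
      assms(3) by simp
qed

definition positive_set :: "'w set" where
  "positive_set = {\<omega>\<in>\<Omega>. \<exists>x\<in>E \<omega> \<inter> C. x \<noteq> 0}"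

text \<open>The strict inequality excludes \<open>x = 0\<close>, so this says that \<open>E \<omega>\<close> contains a unit vector at
  distance less than \<open>\<epsilon>\<close> from the cone.\<close>

definition nearly_positive_set :: "real \<Rightarrow> 'w set" where
  "nearly_positive_set \<epsilon> = {\<omega>\<in>\<Omega>. \<exists>x\<in>E \<omega>. infdist x C < \<epsilon> * norm x}"

text \<open>The existential quantifier ranges over an uncountable fibre. In terms of a measurable basis
  it ranges over coefficient vectors, and rational coefficients suffice.\<close>

lemma nearly_positive_set_measurable: "nearly_positive_set \<epsilon> \<in> sets M"
proof -
  obtain l and v :: "nat \<Rightarrow> 'w \<Rightarrow> 'a"
    where v [measurable]: "\<And>j. j < l \<Longrightarrow> v j \<in> borel_measurable (restrict_space M \<Omega>)"
      and basis: "\<And>\<omega>. \<omega> \<in> \<Omega> \<Longrightarrow> inj_on (\<lambda>j. v j \<omega>) {..<l}"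
        "\<And>\<omega>. \<omega> \<in> \<Omega> \<Longrightarrow> span ((\<lambda>j. v j \<omega>) ` {..<l}) = E \<omega>"
    using measurable_E unfolding measurable_subspaces_def by blast
  define Q :: "(nat \<Rightarrow> real) set" where "Q = {..<l} \<rightarrow>\<^sub>E \<rat>"
  define comb where "comb c \<omega> = (\<Sum>j<l. c j *\<^sub>R v j \<omega>)" for c :: "nat \<Rightarrow> real" and \<omega>
  have E_comb: "E \<omega> = range (\<lambda>c. comb c \<omega>)" if "\<omega> \<in> \<Omega>" for \<omega>
    unfolding comb_def using span_image_eq_range[OF basis(1)[OF that]] basis(2)[OF that] by simp
  have "countable Q"
    unfolding Q_def by (intro countable_PiE countable_rat) auto
  have comb_measurable [measurable]: "comb c \<in> borel_measurable (restrict_space M \<Omega>)" for c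
    unfolding comb_def by measurable
  have infdist_measurable [measurable]: "(\<lambda>x. infdist x C) \<in> borel_measurable borel"
    by (intro borel_measurable_continuous_onI continuous_intros)
  have "nearly_positive_set \<epsilon> =
      (\<Union>c\<in>Q. {\<omega>\<in>space (restrict_space M \<Omega>). infdist (comb c \<omega>) C < \<epsilon> * norm (comb c \<omega>)})"
  proof (intro equalityI subsetI)
    fix \<omega> assume "\<omega> \<in> nearly_positive_set \<epsilon>"
    then obtain x where \<omega>: "\<omega> \<in> \<Omega>" and x: "x \<in> E \<omega>" "infdist x C < \<epsilon> * norm x"
      unfolding nearly_positive_set_def by blast
    then obtain c where c: "infdist (comb c \<omega>) C < \<epsilon> * norm (comb c \<omega>)"
      unfolding E_comb[OF \<omega>] by blast
    \<comment> \<open>The inequality is open in the coefficients, hence holds at rational ones near \<open>c\<close>.\<close>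
    have "\<exists>f. (\<forall>n. f n \<in> \<rat>) \<and> f \<longlonglongrightarrow> c j" for j
      using Rats_closure_real closure_sequential[of "c j" \<rat>] by auto
    then obtain f where f: "\<And>j n. f j n \<in> \<rat>" "\<And>j. f j \<longlonglongrightarrow> c j"
      by metis
    define q where "q n = restrict (\<lambda>j. f j n) {..<l}" for n
    have q: "q n \<in> Q" for n
      using f(1) by (auto simp: q_def Q_def)
    have "(\<lambda>n. \<Sum>j<l. f j n *\<^sub>R v j \<omega>) \<longlonglongrightarrow> comb c \<omega>"
      unfolding comb_def by (intro tendsto_intros f(2))
    moreover have "comb (q n) \<omega> = (\<Sum>j<l. f j n *\<^sub>R v j \<omega>)" for n
      unfolding comb_def q_def by (intro sum.cong) auto
    ultimately have lim: "(\<lambda>n. comb (q n) \<omega>) \<longlonglongrightarrow> comb c \<omega>"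
      by simp
    have "(\<lambda>n. \<epsilon> * norm (comb (q n) \<omega>) - infdist (comb (q n) \<omega>) C)
        \<longlonglongrightarrow> \<epsilon> * norm (comb c \<omega>) - infdist (comb c \<omega>) C"
      by (intro tendsto_intros lim tendsto_infdist)
    then have "eventually (\<lambda>n. 0 < \<epsilon> * norm (comb (q n) \<omega>) - infdist (comb (q n) \<omega>) C) sequentially"
      using c by (intro order_tendstoD(1)) auto
    then obtain n where "0 < \<epsilon> * norm (comb (q n) \<omega>) - infdist (comb (q n) \<omega>) C"
      using eventually_happens'[OF sequentially_bot] by blast
    with q \<omega> show "\<omega> \<in> (\<Union>c\<in>Q. {\<omega>\<in>space (restrict_space M \<Omega>).
        infdist (comb c \<omega>) C < \<epsilon> * norm (comb c \<omega>)})"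
      using \<Omega>_space by (auto simp: space_restrict_space intro!: bexI[of _ "q n"])
  qed (auto simp: nearly_positive_set_def space_restrict_space E_comb)
  also have "\<dots> \<in> sets (restrict_space M \<Omega>)"
    using \<open>countable Q\<close> by (intro sets.countable_UN'') measurable
  finally show ?thesis
    using \<Omega>_sets by (simp add: sets_restrict_space_iff)
qed

text \<open>Compactness of the unit sphere of \<open>E \<omega>\<close> turns vectors arbitrarily near the cone into a vector
  in the cone.\<close>

lemma positive_set_eq_Inter:
  "positive_set = (\<Inter>n. nearly_positive_set (1 / real (Suc n)))"
proof (intro equalityI subsetI)
  fix \<omega> assume "\<omega> \<in> positive_set"
  then obtain x where x: "\<omega> \<in> \<Omega>" "x \<in> E \<omega>" "x \<in> C" "x \<noteq> 0"
    by (auto simp: positive_set_def)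
  then have "infdist x C < 1 / real (Suc n) * norm x" for n
    by simp
  with x show "\<omega> \<in> (\<Inter>n. nearly_positive_set (1 / real (Suc n)))"
    unfolding nearly_positive_set_def by blast
next
  fix \<omega> assume near: "\<omega> \<in> (\<Inter>n. nearly_positive_set (1 / real (Suc n)))"
  then have \<omega>: "\<omega> \<in> \<Omega>" by (auto simp: nearly_positive_set_def)
  define S where "S = E \<omega> \<inter> sphere 0 1"
  have S_near: "\<exists>y\<in>S. infdist y C < 1 / real (Suc n)" for n
  proof -
    obtain x where x: "x \<in> E \<omega>" "infdist x C < 1 / real (Suc n) * norm x"
      using near by (auto simp: nearly_positive_set_def)
    with infdist_nonneg[of x C] have "x \<noteq> 0" by auto
    obtain z where z: "z \<in> C" "dist x z < 1 / real (Suc n) * norm x"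
      using x(2) C_nonempty by (auto simp: infdist_def cINF_less_iff split: if_splits)
    have "dist (x /\<^sub>R norm x) (z /\<^sub>R norm x) = dist x z / norm x"
      using \<open>x \<noteq> 0\<close> by (simp add: dist_norm scaleR_diff_right[symmetric] divide_inverse_commute)
    also have "\<dots> < 1 / real (Suc n)"
      using z(2) \<open>x \<noteq> 0\<close> by (simp add: field_simps)
    finally have "dist (x /\<^sub>R norm x) (z /\<^sub>R norm x) < 1 / real (Suc n)" .
    moreover have "infdist (x /\<^sub>R norm x) C \<le> dist (x /\<^sub>R norm x) (z /\<^sub>R norm x)"
      by (intro infdist_le C_scaleR z(1)) simp
    ultimately have "infdist (x /\<^sub>R norm x) C < 1 / real (Suc n)"
      by (rule le_less_trans[rotated])
    moreover have "x /\<^sub>R norm x \<in> S"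
      using x(1) \<open>x \<noteq> 0\<close> subspace_scale[OF subspace_E[OF \<omega>]] by (simp add: S_def)
    ultimately show ?thesis by blast
  qed
  obtain B where "finite B" "E \<omega> = span B"
    using E_finite_span[OF \<omega>] .
  then have "compact S"
    unfolding S_def by (simp add: compact_span_sphere)
  moreover have "S \<noteq> {}" using S_near by blast
  ultimately obtain x where x: "x \<in> S" "\<And>y. y \<in> S \<Longrightarrow> infdist x C \<le> infdist y C"
    using continuous_attains_inf[of S "\<lambda>x. infdist x C"] continuous_on_infdist[OF continuous_on_id]
    by blast
  have "infdist x C \<le> 0"
  proof (rule ccontr)
    assume "\<not> infdist x C \<le> 0"
    then obtain n where "1 / real (Suc n) < infdist x C"
      by (metis nat_approx_posE not_le)
    then show False using S_near[of n] x(2) by force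
  qed
  then have "x \<in> C"
    using infdist_nonneg[of x C] in_closed_iff_infdist_zero[OF C_closed C_nonempty] by force
  with x(1) \<omega> show "\<omega> \<in> positive_set"
    by (auto simp: positive_set_def S_def intro!: bexI[of _ x])
qed

text \<open>Otherwise \<open>F \<omega>\<close> contains \<open>C - C\<close>, hence its closure, which is the whole space.\<close>

lemma exists_cone_notin_F:
  assumes "\<omega> \<in> \<Omega>"
  shows "\<exists>u\<in>C. u \<notin> F \<omega>"
proof (rule ccontr)
  assume "\<not> ?thesis"
  then have "{u - v |u v. u \<in> C \<and> v \<in> C} \<subseteq> F \<omega>"
    using subspace_diff[OF subspace_F[OF assms]] by blast
  then have "closure {u - v |u v. u \<in> C \<and> v \<in> C} \<subseteq> F \<omega>"
    by (rule closure_minimal[OF _ closed_F[OF assms]])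
  then have "F \<omega> = UNIV"
    using total_cone by (simp add: total_cone_def top.extremum_unique)
  then show False
    using E_inter_F[OF assms] E_nontrivial[OF assms] by simp
qed

text \<open>Split a vector \<open>u\<close> of the cone outside \<open>F \<omega>\<close> as \<open>e + f\<close>. The image of \<open>u\<close> stays in the cone and
  differs from the image of \<open>e\<close>, which lies in \<open>E\<close>, by the image of \<open>f\<close>, which is small relative to
  that of \<open>e\<close>.\<close>

lemma eventually_nearly_positive:
  assumes \<omega>: "\<omega> \<in> \<Omega>" and "\<epsilon> > 0"
  shows "eventually (\<lambda>n. \<theta> (real n) \<omega> \<in> nearly_positive_set \<epsilon>) sequentially"
proof -
  obtain u where u: "u \<in> C" "u \<notin> F \<omega>"
    using exists_cone_notin_F[OF \<omega>] by blast
  obtain e f where ef: "u = e + f" "e \<in> E \<omega>" "f \<in> F \<omega>"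
    using E_plus_F[OF \<omega>] by (metis UNIV_I set_plus_elim)
  with u(2) have "e \<noteq> 0" by auto
  have "eventually (\<lambda>n. norm (U \<omega> (real n) f) / norm (U \<omega> (real n) e) < \<epsilon>) sequentially"
    using domination[OF \<omega> ef(2) \<open>e \<noteq> 0\<close> ef(3)] \<open>\<epsilon> > 0\<close> by (rule order_tendstoD(2))
  then show ?thesis
  proof eventually_elim
    case (elim n)
    interpret bounded_linear "U \<omega> (real n)"
      using \<omega> of_nat_time by (intro bounded_linear_U)
    have "U \<omega> (real n) e \<noteq> 0"
      using cocycle_kernel_E[OF \<omega> of_nat_time(3) ef(2)] \<open>e \<noteq> 0\<close> by blast
    have "infdist (U \<omega> (real n) e) C \<le> dist (U \<omega> (real n) e) (U \<omega> (real n) u)"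
      by (intro infdist_le U_cone \<omega> of_nat_time u)
    also have "\<dots> = norm (U \<omega> (real n) f)"
      by (simp add: ef(1) add dist_norm)
    also have "\<dots> < \<epsilon> * norm (U \<omega> (real n) e)"
      using elim \<open>U \<omega> (real n) e \<noteq> 0\<close> by (simp add: field_simps)
    finally show ?case
      using cocycle_image_E[OF \<omega> of_nat_time(3)] ef(2) flow_in_\<Omega>[OF \<omega> of_nat_time(1)]
      by (auto simp: nearly_positive_set_def)
  qed
qed

lemma positive_set_measurable: "positive_set \<in> sets M"
  unfolding positive_set_eq_Inter
  by (rule sets.countable_INT) (auto intro: nearly_positive_set_measurable)

lemma measure_positive_set: "measure M positive_set = 1"
proof -
  have "measure M (nearly_positive_set (1 / real (Suc n))) = 1" for n
    by (rule eventually_in_imp_measure_1[OF nearly_positive_set_measurable \<Omega>_sets \<Omega>_measure])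
      (rule eventually_nearly_positive, auto)
  then have "AE \<omega> in M. \<forall>n. \<omega> \<in> nearly_positive_set (1 / real (Suc n))"
    unfolding AE_all_countable by (intro allI AE_prob_1)
  then have "AE \<omega> in M. \<omega> \<in> positive_set"
    unfolding positive_set_eq_Inter by simp
  then show ?thesis
    using prob_eq_1[OF positive_set_measurable] by simp
qed

section \<open>Entire orbits in the cone\<close>

lemma positive_set_forward:
  assumes "\<omega> \<in> positive_set" "t \<in> nonneg_times T"
  shows "\<theta> t \<omega> \<in> positive_set"
proof -
  obtain x where x: "\<omega> \<in> \<Omega>" "x \<in> E \<omega>" "x \<in> C" "x \<noteq> 0"
    using assms(1) by (auto simp: positive_set_def)
  have "U \<omega> t x \<in> E (\<theta> t \<omega>) \<inter> C"
    using cocycle_image_E[OF x(1) assms(2)] U_cone[OF x(1) assms(2) x(3)] x(2) by blast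
  moreover have "U \<omega> t x \<noteq> 0"
    using cocycle_kernel_E[OF x(1) assms(2) x(2)] x(4) by blast
  moreover have "t \<in> T" using assms(2) by (simp add: nonneg_times_def)
  ultimately show ?thesis
    using flow_in_\<Omega>[OF x(1)] by (auto simp: positive_set_def)
qed

text \<open>Integer times suffice: positivity carries a nonzero vector of \<open>E \<inter> C\<close> forward from an integer
  time to all later ones, which also makes this set invariant under the flow in both directions.\<close>

definition past_positive_set :: "'w set" where
  "past_positive_set = {\<omega>\<in>\<Omega>. \<forall>n. \<theta> (- real n) \<omega> \<in> positive_set}"

lemma past_positive_set_measurable: "past_positive_set \<in> sets M"
  and measure_past_positive_set: "measure M past_positive_set = 1"
proof -
  have eq: "past_positive_set = \<Omega> \<inter> (\<Inter>n. \<theta> (- real n) -` positive_set \<inter> space M)"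
    using \<Omega>_space by (auto simp: past_positive_set_def)
  have sets: "\<theta> (- real n) -` positive_set \<inter> space M \<in> sets M" for n
    by (rule measurable_sets[OF flow_time_measurable[OF of_nat_time(2)] positive_set_measurable])
  then show *: "past_positive_set \<in> sets M"
    unfolding eq using \<Omega>_sets by (intro sets.Int sets.countable_INT) auto
  have "measure M (\<theta> (- real n) -` positive_set \<inter> space M) = 1" for n
    using measure_flow_vimage[OF of_nat_time(2) positive_set_measurable] measure_positive_set by simp
  then have "AE \<omega> in M. \<forall>n. \<omega> \<in> \<theta> (- real n) -` positive_set \<inter> space M"
    unfolding AE_all_countable by (intro allI AE_prob_1)
  moreover have "AE \<omega> in M. \<omega> \<in> \<Omega>"
    using \<Omega>_measure by (rule AE_prob_1)
  ultimately have "AE \<omega> in M. \<omega> \<in> past_positive_set"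
    unfolding eq by eventually_elim auto
  then show "measure M past_positive_set = 1"
    using prob_eq_1[OF *] by simp
qed

lemma past_positive_set_flow:
  assumes "\<omega> \<in> past_positive_set" "t \<in> T"
  shows "\<theta> t \<omega> \<in> positive_set" and "\<theta> t \<omega> \<in> past_positive_set"
proof -
  have \<omega>: "\<omega> \<in> \<Omega>" "\<omega> \<in> space M"
    using assms(1) \<Omega>_space by (auto simp: past_positive_set_def)
  have pos: "\<theta> s \<omega> \<in> positive_set" if "s \<in> T" for s
  proof -
    obtain n where n: "- s \<le> real n" using real_arch_simple by blast
    have "s + real n \<in> nonneg_times T"
      using n that time_add of_nat_time by (auto simp: nonneg_times_def)
    moreover have "\<theta> (- real n) \<omega> \<in> positive_set"
      using assms(1) by (simp add: past_positive_set_def)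
    moreover have "\<theta> s \<omega> = \<theta> (s + real n) (\<theta> (- real n) \<omega>)"
      using flow_add[of "- real n" "s + real n"] that time_add of_nat_time \<omega> by simp
    ultimately show ?thesis using positive_set_forward by simp
  qed
  then show "\<theta> t \<omega> \<in> positive_set" using assms by blast
  have "\<theta> (- real n) (\<theta> t \<omega>) \<in> positive_set" for n
    using pos[of "t - real n"] flow_add[of t "- real n"] time_diff assms(2) of_nat_time \<omega> by simp
  then show "\<theta> t \<omega> \<in> past_positive_set"
    using flow_in_\<Omega>[OF \<omega>(1) assms(2)] by (simp add: past_positive_set_def)
qed

lemma past_positive_set_subset: "past_positive_set \<subseteq> positive_set"
proof
  fix \<omega> assume \<omega>: "\<omega> \<in> past_positive_set"
  then have "\<omega> \<in> space M" using \<Omega>_space by (simp add: past_positive_set_def)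
  then show "\<omega> \<in> positive_set"
    using past_positive_set_flow(1)[OF \<omega> of_nat_time(1)[of 0]] flow_0 by simp
qed

lemma past_positive_full_invariant: "full_invariant_set M T \<theta> past_positive_set"
  unfolding full_invariant_set_def invariant_set_def
proof (intro conjI ballI past_positive_set_measurable measure_past_positive_set)
  fix t assume t: "t \<in> T"
  show "\<theta> t ` past_positive_set = past_positive_set"
  proof (intro equalityI subsetI)
    fix \<omega> assume \<omega>: "\<omega> \<in> past_positive_set"
    then have "\<omega> \<in> space M" using \<Omega>_space by (simp add: past_positive_set_def)
    then have "\<omega> = \<theta> t (\<theta> (- t) \<omega>)"
      using flow_add[of "- t" t] t time_uminus flow_0 by simp
    then show "\<omega> \<in> \<theta> t ` past_positive_set"
      using past_positive_set_flow(2)[OF \<omega> time_uminus[OF t]] by blast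
  qed (use past_positive_set_flow(2) t in auto)
qed

text \<open>The sets \<open>K n\<close> of normalised images of the unit vectors of \<open>E \<inter> C\<close> over \<open>\<theta> (- n) \<omega>\<close> are compact,
  nonempty and decreasing. Normalising makes them subsets of the unit sphere, so that a common
  point cannot be \<open>0\<close>; scaling the unit vectors back makes the images equal to that point.\<close>

lemma exists_past_positive_vector:
  assumes \<omega>: "\<omega> \<in> past_positive_set"
  shows "\<exists>e. e \<noteq> 0 \<and>
    (\<forall>n. \<exists>y\<in>E (\<theta> (- real n) \<omega>) \<inter> C. U (\<theta> (- real n) \<omega>) (real n) y = e)"
proof -
  have \<omega>\<Omega>: "\<omega> \<in> \<Omega>" and \<omega>M: "\<omega> \<in> space M"
    using \<omega> \<Omega>_space by (auto simp: past_positive_set_def)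
  define p where "p n = \<theta> (- real n) \<omega>" for n
  have p: "p n \<in> \<Omega>" for n
    unfolding p_def by (rule flow_in_\<Omega>[OF \<omega>\<Omega> of_nat_time(2)])
  have p_Suc: "\<theta> 1 (p (Suc n)) = p n" for n
    using flow_add[of "- real (Suc n)" 1] of_nat_time(2)[of "Suc n"] of_nat_time(1)[of 1] \<omega>M
    by (simp add: p_def)
  define S where "S n = E (p n) \<inter> sphere 0 1 \<inter> C" for n
  define K where "K n = (\<lambda>y. U (p n) (real n) y /\<^sub>R norm (U (p n) (real n) y)) ` S n" for n
  have nonzero: "U (p n) t y \<noteq> 0" if "y \<in> E (p n)" "y \<noteq> 0" "t \<in> nonneg_times T" for n t y
    using cocycle_kernel_E[OF p that(3,1)] that(2) by blast
  have "compact (K n)" for n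
  proof -
    obtain B where "finite B" "E (p n) = span B"
      using E_finite_span[OF p] .
    then have "compact (S n)"
      unfolding S_def by (simp add: compact_span_sphere compact_Int_closed C_closed)
    moreover have "continuous_on (S n) (U (p n) (real n))"
      by (intro linear_continuous_on bounded_linear_U p of_nat_time)
    moreover have "U (p n) (real n) y \<noteq> 0" if "y \<in> S n" for y
      using that of_nat_time by (intro nonzero) (auto simp: S_def)
    ultimately show ?thesis
      unfolding K_def by (intro compact_continuous_image continuous_intros) auto
  qed
  moreover have "K n \<noteq> {}" for n
  proof -
    obtain x where x: "x \<in> E (p n)" "x \<in> C" "x \<noteq> 0"
      using \<omega> by (auto simp: past_positive_set_def positive_set_def p_def)
    then have "x /\<^sub>R norm x \<in> S n"
      using subspace_scale[OF subspace_E[OF p]] C_scaleR by (simp add: S_def)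
    then show ?thesis by (auto simp: K_def)
  qed
  moreover have "K (Suc n) \<subseteq> K n" for n
  proof
    fix k assume "k \<in> K (Suc n)"
    then obtain y where y: "y \<in> E (p (Suc n))" "y \<in> C" "norm y = 1"
      and k: "k = U (p (Suc n)) (real (Suc n)) y /\<^sub>R norm (U (p (Suc n)) (real (Suc n)) y)"
      by (auto simp: K_def S_def)
    have one: "1 \<in> nonneg_times T" using of_nat_time(3)[of 1] by simp
    interpret bounded_linear "U (p n) (real n)"
      by (intro bounded_linear_U p of_nat_time)
    define z where "z = U (p (Suc n)) 1 y"
    have z: "z \<in> E (p n)" "z \<in> C"
      using cocycle_image_E[OF p one, of "Suc n"] U_cone[OF p one y(2)] y(1)
      by (auto simp: z_def p_Suc)
    have "z \<noteq> 0"
      unfolding z_def using y by (intro nonzero one) auto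
    have Uy: "U (p (Suc n)) (real (Suc n)) y = U (p n) (real n) z"
      using cocycle_add[of "p (Suc n)" 1 "real n" y, OF \<Omega>_space[OF p] one of_nat_time(3)]
      by (simp add: z_def p_Suc add.commute)
    have "k = U (p n) (real n) (z /\<^sub>R norm z) /\<^sub>R norm (U (p n) (real n) (z /\<^sub>R norm z))"
      unfolding k Uy using \<open>z \<noteq> 0\<close> by (simp add: scaleR)
    moreover have "z /\<^sub>R norm z \<in> S n"
      using z \<open>z \<noteq> 0\<close> subspace_scale[OF subspace_E[OF p]] C_scaleR by (simp add: S_def)
    ultimately show "k \<in> K n" by (auto simp: K_def)
  qed
  ultimately have "(\<Inter>n. K n) \<noteq> {}"
    by (rule compact_nested_Inter)
  then obtain e where e: "\<And>n. e \<in> K n"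
    by blast
  obtain y where y: "y \<in> S 0" "e = U (p 0) (real 0) y /\<^sub>R norm (U (p 0) (real 0) y)"
    using e[of 0] unfolding K_def by blast
  moreover have "U (p 0) (real 0) y \<noteq> 0"
    using y(1) by (intro nonzero of_nat_time) (auto simp: S_def)
  ultimately have "e \<noteq> 0"
    by simp
  moreover have "\<exists>y\<in>E (p n) \<inter> C. U (p n) (real n) y = e" for n
  proof -
    interpret bounded_linear "U (p n) (real n)"
      by (intro bounded_linear_U p of_nat_time)
    obtain y where y: "y \<in> S n" "e = U (p n) (real n) y /\<^sub>R norm (U (p n) (real n) y)"
      using e[of n] unfolding K_def by blast
    then have "e = U (p n) (real n) (y /\<^sub>R norm (U (p n) (real n) y))"
      by (simp add: scaleR)
    then show ?thesis
      using y(1) subspace_scale[OF subspace_E[OF p]] C_scaleR by (force simp: S_def)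
  qed
  ultimately show ?thesis unfolding p_def by blast
qed

text \<open>Let \<open>y n\<close> be a preimage of the vector \<open>e\<close> above over \<open>\<theta> (- n) \<omega>\<close>. Injectivity on \<open>E\<close> makes the
  \<open>y n\<close> consistent with each other, so that the value at \<open>t\<close> may be computed by starting from any
  \<open>- n \<le> t\<close>.\<close>

lemma exists_positive_entire_orbit:
  assumes \<omega>: "\<omega> \<in> past_positive_set"
  shows "\<exists>v. entire_orbit T \<theta> U \<omega> v \<and> (\<forall>t\<in>T. v t \<in> E (\<theta> t \<omega>) \<inter> C \<and> v t \<noteq> 0)"
proof -
  have \<omega>\<Omega>: "\<omega> \<in> \<Omega>" and \<omega>M: "\<omega> \<in> space M"
    using \<omega> \<Omega>_space by (auto simp: past_positive_set_def)
  define p where "p n = \<theta> (- real n) \<omega>" for n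
  have p: "p n \<in> \<Omega>" for n
    unfolding p_def by (rule flow_in_\<Omega>[OF \<omega>\<Omega> of_nat_time(2)])
  have flow_p: "\<theta> (t + real n) (p n) = \<theta> t \<omega>" if "t \<in> T" for t n
    using flow_add[of "- real n" "t + real n"] that time_add of_nat_time \<omega>M by (simp add: p_def)
  obtain e where "e \<noteq> 0" and "\<forall>n. \<exists>y\<in>E (p n) \<inter> C. U (p n) (real n) y = e"
    using exists_past_positive_vector[OF \<omega>] unfolding p_def by blast
  then obtain y where y: "\<And>n. y n \<in> E (p n)" "\<And>n. y n \<in> C" "\<And>n. U (p n) (real n) (y n) = e"
    unfolding bchoice_iff Bex_def choice_iff by blast
  have y_shift: "U (p (m + n)) (real m) (y (m + n)) = y n" for m n
  proof (rule inj_onD[OF cocycle_inj_on_E[OF p of_nat_time(3)]])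
    have pm: "\<theta> (real m) (p (m + n)) = p n"
      using flow_p[OF of_nat_time(2)[of n], of "m + n"] by (simp add: p_def)
    show "U (p n) (real n) (U (p (m + n)) (real m) (y (m + n))) = U (p n) (real n) (y n)"
      using cocycle_add[of "p (m + n)" "real m" "real n" "y (m + n)",
          OF \<Omega>_space[OF p] of_nat_time(3) of_nat_time(3)]
        y(3)[of "m + n"] y(3)[of n] by (simp add: pm add.commute)
    show "U (p (m + n)) (real m) (y (m + n)) \<in> E (p n)"
      using cocycle_image_E[of "p (m + n)" "real m", OF p of_nat_time(3)] y(1) by (auto simp: pm)
  qed (rule y(1))
  \<comment> \<open>Start from the greatest nonpositive integer time that is at most \<open>t\<close>.\<close>
  define v where "v t = U (p (nat \<lceil>- t\<rceil>)) (t + real (nat \<lceil>- t\<rceil>)) (y (nat \<lceil>- t\<rceil>))" for t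
  have later: "t + real n \<in> nonneg_times T" if "t \<in> T" "- t \<le> real n" for t n
    using that time_add of_nat_time by (auto simp: nonneg_times_def)
  have v: "v t = U (p n) (t + real n) (y n)" if t: "t \<in> T" "- t \<le> real n" for t n
  proof -
    define n0 where "n0 = nat \<lceil>- t\<rceil>"
    have n0: "- t \<le> real n0" unfolding n0_def by (rule real_nat_ceiling_ge)
    have "n0 \<le> n" unfolding n0_def using t(2) by (simp add: nat_le_iff ceiling_le_iff)
    then obtain m where m: "n = m + n0" by (metis le_add_diff_inverse2)
    have "U (p n0) (t + real n0) (U (p n) (real m) (y n)) = U (p n) (t + real n0 + real m) (y n)"
      using cocycle_add[of "p n" "real m" "t + real n0" "y n",
          OF \<Omega>_space[OF p] of_nat_time(3) later[OF t(1) n0]]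
        flow_p[OF of_nat_time(2)[of n0], of n] by (simp add: m p_def)
    then show ?thesis
      using y_shift[of m n0] by (simp add: v_def n0_def[symmetric] m ac_simps)
  qed
  have arch: "\<exists>n. - t \<le> real n" for t :: real
    by (rule real_arch_simple)
  have "entire_orbit T \<theta> U \<omega> v"
    unfolding entire_orbit_def
  proof (intro ballI)
    fix s t assume s: "s \<in> T" and t: "t \<in> nonneg_times T"
    then have t': "t \<in> T" "0 \<le> t" by (auto simp: nonneg_times_def)
    obtain n where n: "- s \<le> real n" using arch by blast
    have "v (s + t) = U (p n) (t + (s + real n)) (y n)"
      using v[of "s + t" n] n t' time_add[OF s t'(1)] by (simp add: ac_simps)
    also have "\<dots> = U (\<theta> s \<omega>) t (U (p n) (s + real n) (y n))"
      using cocycle_add[of "p n" "s + real n" t "y n", OF \<Omega>_space[OF p] later[OF s n] t]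
        flow_p[OF s, of n] by simp
    finally show "v (s + t) = U (\<theta> s \<omega>) t (v s)"
      using v[OF s n] by simp
  qed
  moreover have "v t \<in> E (\<theta> t \<omega>) \<inter> C \<and> v t \<noteq> 0" if t: "t \<in> T" for t
  proof -
    obtain n where n: "- t \<le> real n" using arch by blast
    interpret bounded_linear "U (p n) (real n)"
      by (intro bounded_linear_U p of_nat_time)
    have "y n \<noteq> 0"
      using y(3)[of n] \<open>e \<noteq> 0\<close> zero by force
    then have "v t \<noteq> 0"
      unfolding v[OF t n] using cocycle_kernel_E[OF p later[OF t n] y(1)] by blast
    moreover have "v t \<in> E (\<theta> t \<omega>)"
      unfolding v[OF t n] flow_p[OF t, of n, symmetric] cocycle_image_E[OF p later[OF t n], symmetric]
      using y(1) by (rule imageI)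
    moreover have "v t \<in> C"
      unfolding v[OF t n] by (intro U_cone p later t n y)
    ultimately show ?thesis by blast
  qed
  ultimately show ?thesis by blast
qed

end

section \<open>The Oseledets decomposition as a dominated splitting\<close>


context linear_skew_product
begin

lemma eventually_nonneg_times: "eventually (\<lambda>t. t \<in> nonneg_times T) (at_top_in T)"
  unfolding at_top_in_def eventually_inf_principal nonneg_times_def
  using eventually_ge_at_top[of "0::real"] by eventually_elim simp

lemma growth_rate_to_two_sided:
  "growth_rate_to (at_top_in T) (\<lambda>t. norm (two_sided \<theta> U E \<omega> t u)) r \<longleftrightarrow>
   growth_rate_to (at_top_in T) (\<lambda>t. norm (U \<omega> t u)) r"
  unfolding growth_rate_to_def
proof (rule tendsto_cong)
  show "eventually (\<lambda>t. ereal (1 / t) * ln_ext (norm (two_sided \<theta> U E \<omega> t u)) =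
      ereal (1 / t) * ln_ext (norm (U \<omega> t u))) (at_top_in T)"
    using eventually_nonneg_times
    by eventually_elim (simp add: two_sided_def nonneg_times_def)
qed

text \<open>Once an orbit reaches \<open>0\<close> it stays there, and its growth rate is \<open>-\<infinity>\<close>.\<close>

lemma growth_rate_imp_nonzero:
  assumes \<omega>: "\<omega> \<in> space M" and t: "t \<in> nonneg_times T"
    and growth: "growth_rate_to (at_top_in T) (\<lambda>s. norm (U \<omega> s e)) (ereal r)"
  shows "U \<omega> t e \<noteq> 0"
proof
  assume zero: "U \<omega> t e = 0"
  have "eventually (\<lambda>s. exp ((r - 1) * s) \<le> norm (U \<omega> s e)) (at_top_in T)"
    by (rule growth_rate_to_lower[OF growth]) simp
  moreover have "eventually (\<lambda>s. s \<in> T \<and> t \<le> s) (at_top_in T)"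
    unfolding at_top_in_def eventually_inf_principal
    using eventually_ge_at_top[of t] by eventually_elim simp
  ultimately have "eventually (\<lambda>_. False) (at_top_in T)"
  proof eventually_elim
    case (elim s)
    have tT: "t \<in> T" using t by (simp add: nonneg_times_def)
    have st: "s - t \<in> nonneg_times T"
      using elim(2) time_diff[OF _ tT] by (simp add: nonneg_times_def)
    interpret bounded_linear "U (\<theta> t \<omega>) (s - t)"
      using measurable_space[OF flow_time_measurable[OF tT] \<omega>] st by (rule cocycle_linear)
    have "U \<omega> s e = U (\<theta> t \<omega>) (s - t) (U \<omega> t e)"
      using cocycle_add[OF \<omega> t st] by simp
    then have "U \<omega> s e = 0" by (simp add: zero \<open>U \<omega> t e = 0\<close>)
    moreover have "0 < exp ((r - 1) * s)" by simp
    ultimately show False using elim(1) by (metis norm_zero not_le)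
  qed
  then show False
    using at_top_in_nontrivial by (simp add: trivial_limit_def)
qed

text \<open>The members of \<open>F\<^sub>1\<close> have different growth rates, and it is the set of all vectors with an orbit
  negligible relative to that of \<open>e\<close> which is closed under addition.\<close>

definition subordinate :: "'w \<Rightarrow> 'a \<Rightarrow> 'a set" where
  "subordinate \<omega> e =
     {f. ((\<lambda>t. norm (U \<omega> t f) / norm (U \<omega> t e)) \<longlongrightarrow> 0) (at_top_in T)}"

lemma subordinate_0:
  assumes "\<omega> \<in> space M"
  shows "0 \<in> subordinate \<omega> e"
proof -
  have "eventually (\<lambda>t. 0 = norm (U \<omega> t 0) / norm (U \<omega> t e)) (at_top_in T)"
    using eventually_nonneg_times
  proof eventually_elim
    case (elim t)
    interpret bounded_linear "U \<omega> t" using assms elim by (rule cocycle_linear)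
    show ?case by (simp add: zero)
  qed
  then show ?thesis
    unfolding subordinate_def mem_Collect_eq by (rule Lim_transform_eventually[OF tendsto_const])
qed

lemma subordinate_add:
  assumes \<omega>: "\<omega> \<in> space M" and f: "f \<in> subordinate \<omega> e" and g: "g \<in> subordinate \<omega> e"
  shows "f + g \<in> subordinate \<omega> e"
proof -
  have lim: "((\<lambda>t. norm (U \<omega> t f) / norm (U \<omega> t e) + norm (U \<omega> t g) / norm (U \<omega> t e)) \<longlongrightarrow> 0)
      (at_top_in T)"
    using f g unfolding subordinate_def by (auto intro: tendsto_add_zero)
  have "eventually (\<lambda>t. norm (norm (U \<omega> t (f + g)) / norm (U \<omega> t e))
      \<le> norm (U \<omega> t f) / norm (U \<omega> t e) + norm (U \<omega> t g) / norm (U \<omega> t e)) (at_top_in T)"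
    using eventually_nonneg_times
  proof eventually_elim
    case (elim t)
    interpret bounded_linear "U \<omega> t" using \<omega> elim by (rule cocycle_linear)
    show ?case
      using norm_triangle_ineq[of "U \<omega> t f" "U \<omega> t g"]
      by (simp add: add add_divide_distrib[symmetric] divide_right_mono)
  qed
  then show ?thesis
    unfolding subordinate_def mem_Collect_eq by (rule Lim_null_comparison[OF _ lim])
qed

lemma subordinate_sum:
  assumes "\<omega> \<in> space M" "\<And>j. j \<in> J \<Longrightarrow> s j \<in> subordinate \<omega> e"
  shows "sum s J \<in> subordinate \<omega> e"
  using assms(2)
proof (induction J rule: infinite_finite_induct)
  case (insert j J)
  then show ?case using subordinate_add[OF assms(1)] by simp
qed (simp_all add: subordinate_0 assms(1))

lemma subordinate_vector:
  assumes "growth_rate_to (at_top_in T) (\<lambda>t. norm (U \<omega> t e)) r"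
    and "growth_rate_to (at_top_in T) (\<lambda>t. norm (U \<omega> t f)) s" and "s < r"
  shows "f \<in> subordinate \<omega> e"
  unfolding subordinate_def mem_Collect_eq
  by (rule growth_rate_ratio_tendsto_0[OF assms(2,1,3), of 1]) simp_all

lemma subordinate_subspace:
  assumes "\<omega> \<in> space M" "growth_rate_to (at_top_in T) (\<lambda>t. norm (U \<omega> t e)) r"
    and "growth_rate_to (at_top_in T) (\<lambda>t. onorm_on G (U \<omega> t)) s" and "s < r" and "f \<in> G"
  shows "f \<in> subordinate \<omega> e"
proof -
  have "eventually (\<lambda>t. 0 \<le> norm (U \<omega> t f) \<and> norm (U \<omega> t f) \<le> norm f * onorm_on G (U \<omega> t))
      (at_top_in T)"
    using eventually_nonneg_times
  proof eventually_elim
    case (elim t)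
    show ?case
      using norm_le_onorm_on[OF cocycle_linear[OF assms(1) elim] assms(5)] by (simp add: mult.commute)
  qed
  then show ?thesis
    unfolding subordinate_def mem_Collect_eq
    by (rule growth_rate_ratio_tendsto_0[OF assms(3,2,4) norm_ge_zero])
qed

lemma oseledets_level_finite_span:
  assumes "oseledets_level M T \<theta> U \<Omega> r E E' F" "\<omega> \<in> \<Omega>"
  shows "\<exists>B. finite B \<and> E \<omega> = span B"
  using assms(1)[unfolded oseledets_level_def, THEN conjunct1] assms(2)
  by (rule measurable_subspaces_finite_span)

lemma oseledets_level_growth:
  assumes "oseledets_level M T \<theta> U \<Omega> r E E' F" "\<omega> \<in> \<Omega>" "e \<in> E \<omega>" "e \<noteq> 0"
  shows "growth_rate_to (at_top_in T) (\<lambda>t. norm (U \<omega> t e)) (ereal r)"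
proof -
  have "growth_rate_to (at_top_in T) (\<lambda>t. norm (two_sided \<theta> U E \<omega> t e)) (ereal r)"
    using assms unfolding oseledets_level_def by blast
  then show ?thesis unfolding growth_rate_to_two_sided .
qed

text \<open>The operator norm on \<open>{0}\<close> is \<open>0\<close> and does not grow at a finite rate.\<close>

lemma oseledets_level_nontrivial:
  assumes "oseledets_level M T \<theta> U \<Omega> r E E' F" "\<omega> \<in> \<Omega>"
  shows "E \<omega> \<noteq> {0}"
proof
  assume E: "E \<omega> = {0}"
  have "growth_rate_to (at_top_in T) (\<lambda>t. onorm_on (E \<omega>) (two_sided \<theta> U E \<omega> t)) (ereal r)"
    using assms unfolding oseledets_level_def by blast
  then have "growth_rate_to (at_top_in T) (\<lambda>t. 0) (ereal r)"
    by (simp add: onorm_on_def E)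
  then have "eventually (\<lambda>t. exp ((r - 1) * t) \<le> 0) (at_top_in T)"
    by (rule growth_rate_to_lower) simp
  then show False
    using at_top_in_nontrivial by (simp add: trivial_limit_def)
qed

text \<open>Injectivity of the cocycle on \<open>E\<close> comes from the finite growth rates there, and so holds over
  every point of \<open>\<Omega>\<close>, not only over almost every one.\<close>

lemma dominated_splittingI:
  assumes \<Omega>: "full_invariant_set M T \<theta> \<Omega>"
    and level: "oseledets_level M T \<theta> U \<Omega> r E E' F'"
    and F: "\<And>\<omega>. \<omega> \<in> \<Omega> \<Longrightarrow> subspace (F \<omega>) \<and> closed (F \<omega>)"
    and split: "\<And>\<omega>. \<omega> \<in> \<Omega> \<Longrightarrow> E \<omega> + F \<omega> = UNIV \<and> E \<omega> \<inter> F \<omega> = {0}"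
    and sub: "\<And>\<omega> e. \<omega> \<in> \<Omega> \<Longrightarrow> e \<in> E \<omega> \<Longrightarrow> e \<noteq> 0 \<Longrightarrow> F \<omega> \<subseteq> subordinate \<omega> e"
  shows "dominated_splitting M T \<theta> U \<Omega> E F"
proof unfold_locales
  have space: "\<omega> \<in> space M" if "\<omega> \<in> \<Omega>" for \<omega>
    using that \<Omega> sets.sets_into_space unfolding full_invariant_set_def by blast
  show "measurable_subspaces M \<Omega> E"
    using level by (simp add: oseledets_level_def)
  show "U \<omega> t ` E \<omega> = E (\<theta> t \<omega>)" if "\<omega> \<in> \<Omega>" "t \<in> nonneg_times T" for \<omega> t
    using level that by (simp add: oseledets_level_def)
  show "e = 0" if "\<omega> \<in> \<Omega>" "t \<in> nonneg_times T" "e \<in> E \<omega>" "U \<omega> t e = 0" for \<omega> t e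
    using growth_rate_imp_nonzero[OF space[OF that(1)] that(2) oseledets_level_growth[OF level that(1,3)]]
      that(4) by blast
  show "E \<omega> \<noteq> {0}" if "\<omega> \<in> \<Omega>" for \<omega>
    using level that by (rule oseledets_level_nontrivial)
  show "(\<lambda>n. norm (U \<omega> (real n) f) / norm (U \<omega> (real n) e)) \<longlonglongrightarrow> 0"
    if "\<omega> \<in> \<Omega>" "e \<in> E \<omega>" "e \<noteq> 0" "f \<in> F \<omega>" for \<omega> e f
    using filterlim_compose[OF _ sequence_at_top_in] sub[OF that(1-3)] that(4)
    unfolding subordinate_def by blast
qed (use \<Omega> F split in auto)

text \<open>A vector of \<open>F\<^sub>1\<close> is a finite sum of vectors of \<open>E\<^sub>2, \<dots>, E\<^sub>k\<close> and \<open>F\<^sub>\<infinity>\<close>, each of them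
  subordinate to every nonzero vector of \<open>E\<^sub>1\<close>.\<close>

lemma oseledets_finite_dominated_splitting:
  assumes "oseledets_finite M T \<theta> U \<Omega> k lam E Finf"
  shows "dominated_splitting M T \<theta> U \<Omega> (E 1) (\<lambda>\<omega>. (\<Sum>j\<in>{Suc 1..k}. E j \<omega>) + Finf \<omega>)"
proof -
  have \<Omega>: "full_invariant_set M T \<theta> \<Omega>" and k: "1 \<le> k"
    and lam: "\<And>i. i \<in> {1..<k} \<Longrightarrow> lam (Suc i) < lam i"
    and Finf: "\<And>\<omega>. \<omega> \<in> \<Omega> \<Longrightarrow> subspace (Finf \<omega>) \<and> closed (Finf \<omega>)"
    and sum: "\<And>\<omega>. \<omega> \<in> \<Omega> \<Longrightarrow> direct_sum {1..Suc k} ((\<lambda>j. E j \<omega>)(Suc k := Finf \<omega>)) UNIV"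
    and growth: "\<And>\<omega>. \<omega> \<in> \<Omega> \<Longrightarrow> growth_rate_to (at_top_in T) (\<lambda>t. onorm_on (Finf \<omega>) (U \<omega> t)) (-\<infinity>)"
    and level: "\<And>i. i \<in> {1..k} \<Longrightarrow> oseledets_level M T \<theta> U \<Omega> (lam i) (E i)
        (\<lambda>\<omega>. \<Sum>j\<in>{1..i}. E j \<omega>) (\<lambda>\<omega>. (\<Sum>j\<in>{Suc i..k}. E j \<omega>) + Finf \<omega>)"
    using assms unfolding oseledets_finite_def closed_finite_codim_subspaces_def by auto
  have lam1: "lam (Suc j) < lam 1" if "1 \<le> j" "Suc j \<le> k" for j
    using that
  proof (induction j rule: dec_induct)
    case base
    then show ?case using lam[of 1] by simp
  next
    case (step j)
    then show ?case using lam[of "Suc j"] by auto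
  qed
  have level1: "oseledets_level M T \<theta> U \<Omega> (lam 1) (E 1)
        (\<lambda>\<omega>. \<Sum>j\<in>{1..1}. E j \<omega>) (\<lambda>\<omega>. (\<Sum>j\<in>{Suc 1..k}. E j \<omega>) + Finf \<omega>)"
    using k by (intro level) simp
  have space: "\<omega> \<in> space M" if "\<omega> \<in> \<Omega>" for \<omega>
    using that \<Omega> sets.sets_into_space unfolding full_invariant_set_def by blast
  have fin: "\<exists>B. finite B \<and> E j \<omega> = span B" if "\<omega> \<in> \<Omega>" "j \<in> {1..k}" for \<omega> j
    using oseledets_level_finite_span[OF level[OF that(2)] that(1)] .
  show ?thesis
  proof (rule dominated_splittingI[OF \<Omega> level1])
    fix \<omega> assume \<omega>: "\<omega> \<in> \<Omega>"
    show "subspace ((\<Sum>j\<in>{Suc 1..k}. E j \<omega>) + Finf \<omega>) \<and> closed ((\<Sum>j\<in>{Suc 1..k}. E j \<omega>) + Finf \<omega>)"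
      using Finf[OF \<omega>] fin[OF \<omega>] by (intro closed_subspace_plus_finite_sum) auto
    define V where "V = (\<lambda>j. E j \<omega>)(Suc k := Finf \<omega>)"
    have "subspace (V j)" if j: "j \<in> {1..Suc k}" for j
    proof (cases "j = Suc k")
      case False
      then obtain B where "E j \<omega> = span B" using fin[OF \<omega>, of j] j by auto
      then show ?thesis using False by (simp add: V_def)
    qed (use Finf[OF \<omega>] in \<open>simp add: V_def\<close>)
    note splitV = direct_sum_split[OF sum[OF \<omega>, folded V_def] _ _ this, of 1]
    have "{1..Suc k} - {1} = insert (Suc k) {Suc 1..k}"
      using k by auto
    then have "(\<Sum>j\<in>{1..Suc k} - {1}. V j) = V (Suc k) + (\<Sum>j\<in>{Suc 1..k}. V j)"
      by simp
    also have "(\<Sum>j\<in>{Suc 1..k}. V j) = (\<Sum>j\<in>{Suc 1..k}. E j \<omega>)"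
      by (rule sum.cong) (auto simp: V_def)
    finally have "(\<Sum>j\<in>{1..Suc k} - {1}. V j) = (\<Sum>j\<in>{Suc 1..k}. E j \<omega>) + Finf \<omega>"
      by (simp add: V_def add.commute)
    moreover have "V 1 = E 1 \<omega>" using k by (simp add: V_def)
    ultimately show "E 1 \<omega> + ((\<Sum>j\<in>{Suc 1..k}. E j \<omega>) + Finf \<omega>) = UNIV \<and>
        E 1 \<omega> \<inter> ((\<Sum>j\<in>{Suc 1..k}. E j \<omega>) + Finf \<omega>) = {0}"
      using splitV k by simp
    fix e assume e: "e \<in> E 1 \<omega>" "e \<noteq> 0"
    note growth_e = oseledets_level_growth[OF level1 \<omega> e]
    have E_sub: "f \<in> subordinate \<omega> e" if j: "j \<in> {Suc 1..k}" and f: "f \<in> E j \<omega>" for j f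
    proof (cases "f = 0")
      case False
      have "growth_rate_to (at_top_in T) (\<lambda>t. norm (U \<omega> t f)) (ereal (lam j))"
        using j by (intro oseledets_level_growth[OF level \<omega> f False]) auto
      moreover have "lam j < lam 1" using lam1[of "j - 1"] j by auto
      ultimately show ?thesis by (intro subordinate_vector[OF growth_e]) auto
    qed (simp add: subordinate_0 space \<omega>)
    show "(\<Sum>j\<in>{Suc 1..k}. E j \<omega>) + Finf \<omega> \<subseteq> subordinate \<omega> e"
    proof
      fix f assume "f \<in> (\<Sum>j\<in>{Suc 1..k}. E j \<omega>) + Finf \<omega>"
      then obtain s w where "f = sum s {Suc 1..k} + w" "\<And>j. j \<in> {Suc 1..k} \<Longrightarrow> s j \<in> E j \<omega>"
        and w: "w \<in> Finf \<omega>"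
        by (auto simp: set_sum_alt elim!: set_plus_elim)
      moreover have "w \<in> subordinate \<omega> e"
        using subordinate_subspace[OF space[OF \<omega>] growth_e growth[OF \<omega>] _ w] by simp
      ultimately show "f \<in> subordinate \<omega> e"
        using E_sub by (auto intro!: subordinate_add subordinate_sum space \<omega>)
    qed
  qed
qed

lemma oseledets_infinite_dominated_splitting:
  assumes "oseledets_infinite M T \<theta> U \<Omega> lam E F"
  shows "dominated_splitting M T \<theta> U \<Omega> (E 1) (F 1)"
proof -
  note D = assms[unfolded oseledets_infinite_def]
  note D1 = D[THEN conjunct2, THEN conjunct2, THEN conjunct2, rule_format, OF order_refl]
  have \<Omega>: "full_invariant_set M T \<theta> \<Omega>"
    using D by (rule conjunct1)
  have lam: "lam (Suc 1) < lam 1"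
    using D[THEN conjunct2, THEN conjunct1] by blast
  have F: "\<And>\<omega>. \<omega> \<in> \<Omega> \<Longrightarrow> subspace (F 1 \<omega>) \<and> closed (F 1 \<omega>)"
    and sum: "\<And>\<omega>. \<omega> \<in> \<Omega> \<Longrightarrow> direct_sum {1..Suc 1} ((\<lambda>j. E j \<omega>)(Suc 1 := F 1 \<omega>)) UNIV"
    and growth: "\<And>\<omega>. \<omega> \<in> \<Omega> \<Longrightarrow>
        growth_rate_to (at_top_in T) (\<lambda>t. onorm_on (F 1 \<omega>) (U \<omega> t)) (ereal (lam (Suc 1)))"
    and level: "oseledets_level M T \<theta> U \<Omega> (lam 1) (E 1) (\<lambda>\<omega>. \<Sum>j\<in>{1..1}. E j \<omega>) (F 1)"
    using D1 unfolding closed_finite_codim_subspaces_def by blast+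
  have space: "\<omega> \<in> space M" if "\<omega> \<in> \<Omega>" for \<omega>
    using that \<Omega> sets.sets_into_space unfolding full_invariant_set_def by blast
  show ?thesis
  proof (rule dominated_splittingI[OF \<Omega> level F])
    fix \<omega> assume \<omega>: "\<omega> \<in> \<Omega>"
    define V where "V = (\<lambda>j. E j \<omega>)(Suc 1 := F 1 \<omega>)"
    have I: "{1..Suc 1} = {1::nat, Suc 1}" by auto
    have "subspace (V j)" if "j \<in> {1..Suc 1}" for j
      using that F[OF \<omega>] oseledets_level_finite_span[OF level \<omega>] unfolding I
      by (auto simp: V_def)
    note splitV = direct_sum_split[OF sum[OF \<omega>, folded V_def] _ _ this, of 1]
    have "{1..Suc 1} - {1} = {Suc 1}" by auto
    then show "E 1 \<omega> + F 1 \<omega> = UNIV \<and> E 1 \<omega> \<inter> F 1 \<omega> = {0}"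
      using splitV by (simp add: V_def)
    fix e assume e: "e \<in> E 1 \<omega>" "e \<noteq> 0"
    show "F 1 \<omega> \<subseteq> subordinate \<omega> e"
      using subordinate_subspace[OF space[OF \<omega>] oseledets_level_growth[OF level \<omega> e] growth[OF \<omega>]]
        lam by auto
  qed
qed

end

text \<open>The orbits are constructed over an invariant subset of \<open>\<Omega>\<^sub>0\<close>. All requirements on a
  decomposition refer to points, or to almost all points, of the underlying set, and so pass to
  an invariant subset of full measure.\<close>

lemma ball_subset: "\<forall>x\<in>A. P x \<Longrightarrow> B \<subseteq> A \<Longrightarrow> \<forall>x\<in>B. P x"
  by blast

lemma measurable_subspaces_mono:
  fixes M :: "'w measure" and E :: "'w \<Rightarrow> 'a::real_normed_vector set"
  assumes "\<Omega>' \<subseteq> \<Omega>" "measurable_subspaces M \<Omega> E"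
  shows "measurable_subspaces M \<Omega>' E"
proof -
  obtain l and v :: "nat \<Rightarrow> 'w \<Rightarrow> 'a" where v: "\<forall>j<l. v j \<in> borel_measurable (restrict_space M \<Omega>)"
    and basis: "\<forall>\<omega>\<in>\<Omega>. inj_on (\<lambda>j. v j \<omega>) {..<l} \<and> independent ((\<lambda>j. v j \<omega>) ` {..<l}) \<and>
      span ((\<lambda>j. v j \<omega>) ` {..<l}) = E \<omega>"
    using assms(2) unfolding measurable_subspaces_def by blast
  show ?thesis
    unfolding measurable_subspaces_def
  proof (intro exI[of _ l] exI[of _ v] conjI)
    show "\<forall>j<l. v j \<in> borel_measurable (restrict_space M \<Omega>')"
      using v by (intro allI impI measurable_restrict_mono[OF _ assms(1)]) simp
  qed (rule ball_subset[OF basis assms(1)])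
qed

lemma strongly_measurable_projections_mono:
  assumes "\<Omega>' \<subseteq> \<Omega>" "strongly_measurable_projections M \<Omega> E F"
  shows "strongly_measurable_projections M \<Omega>' E F"
  unfolding strongly_measurable_projections_def
  by (rule allI, rule measurable_restrict_mono[OF _ assms(1)],
      rule spec[OF assms(2)[unfolded strongly_measurable_projections_def]])

lemma tempered_projections_mono:
  assumes "\<Omega>' \<subseteq> \<Omega>" "tempered_projections M T \<theta> \<Omega> E F"
  shows "tempered_projections M T \<theta> \<Omega>' E F"
  unfolding tempered_projections_def
  by (rule AE_mp[OF assms(2)[unfolded tempered_projections_def]], rule AE_I2)
    (blast dest: subsetD[OF assms(1)])

lemma closed_finite_codim_subspaces_mono:
  assumes "\<Omega>' \<subseteq> \<Omega>" "closed_finite_codim_subspaces \<Omega> F"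
  shows "closed_finite_codim_subspaces \<Omega>' F"
  using assms unfolding closed_finite_codim_subspaces_def by blast

lemma oseledets_level_mono:
  assumes sub: "\<Omega>' \<subseteq> \<Omega>" and level: "oseledets_level M T \<theta> U \<Omega> r E E' F"
  shows "oseledets_level M T \<theta> U \<Omega>' r E E' F"
proof -
  note level' = level[unfolded oseledets_level_def]
  note rest = level'[THEN conjunct2]
  show ?thesis
    unfolding oseledets_level_def
    by (intro conjI measurable_subspaces_mono[OF sub level'[THEN conjunct1]]
        strongly_measurable_projections_mono[OF sub rest[THEN conjunct1]]
        tempered_projections_mono[OF sub rest[THEN conjunct2, THEN conjunct1]]
        ball_subset[OF rest[THEN conjunct2, THEN conjunct2] sub])
qed

lemma oseledets_finite_mono:
  assumes sub: "\<Omega>' \<subseteq> \<Omega>" and full: "full_invariant_set M T \<theta> \<Omega>'"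
    and fin: "oseledets_finite M T \<theta> U \<Omega> k lam E Finf"
  shows "oseledets_finite M T \<theta> U \<Omega>' k lam E Finf"
proof -
  note D2 = fin[unfolded oseledets_finite_def, THEN conjunct2]
  note D4 = D2[THEN conjunct2, THEN conjunct2]
  note D5 = D4[THEN conjunct2]
  have "oseledets_level M T \<theta> U \<Omega>' (lam i) (E i)
      (\<lambda>\<omega>. \<Sum>j\<in>{1..i}. E j \<omega>) (\<lambda>\<omega>. (\<Sum>j\<in>{Suc i..k}. E j \<omega>) + Finf \<omega>)" if "i \<in> {1..k}" for i
    by (rule oseledets_level_mono[OF sub bspec[OF D5[THEN conjunct2] that]])
  then show ?thesis
    unfolding oseledets_finite_def
    by (rule conjI[OF full conjI[OF D2[THEN conjunct1] conjI[OF D2[THEN conjunct2, THEN conjunct1]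
          conjI[OF closed_finite_codim_subspaces_mono[OF sub D4[THEN conjunct1]]
            conjI[OF ball_subset[OF D5[THEN conjunct1] sub] ballI]]]]])
qed

lemma oseledets_infinite_mono:
  assumes sub: "\<Omega>' \<subseteq> \<Omega>" and full: "full_invariant_set M T \<theta> \<Omega>'"
    and inf: "oseledets_infinite M T \<theta> U \<Omega> lam E F"
  shows "oseledets_infinite M T \<theta> U \<Omega>' lam E F"
proof -
  note D2 = inf[unfolded oseledets_infinite_def, THEN conjunct2]
  have "closed_finite_codim_subspaces \<Omega>' (F i) \<and>
        (\<forall>\<omega>\<in>\<Omega>'.
           direct_sum {1..Suc i} ((\<lambda>j. E j \<omega>)(Suc i := F i \<omega>)) UNIV \<and>
           direct_sum2 (E (Suc i) \<omega>) (F (Suc i) \<omega>) (F i \<omega>) \<and>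
           (\<forall>t\<in>nonneg_times T. U \<omega> t ` F i \<omega> \<subseteq> F i (\<theta> t \<omega>)) \<and>
           growth_rate_to (at_top_in T) (\<lambda>t. onorm_on (F i \<omega>) (U \<omega> t)) (ereal (lam (Suc i)))) \<and>
        oseledets_level M T \<theta> U \<Omega>' (lam i) (E i) (\<lambda>\<omega>. \<Sum>j\<in>{1..i}. E j \<omega>) (F i)" (is "?level i")
    if "1 \<le> i" for i
  proof -
    note L = D2[THEN conjunct2, THEN conjunct2, THEN spec, THEN mp, OF that]
    show ?thesis
      by (intro conjI closed_finite_codim_subspaces_mono[OF sub L[THEN conjunct1]]
          ball_subset[OF L[THEN conjunct2, THEN conjunct1] sub]
          oseledets_level_mono[OF sub L[THEN conjunct2, THEN conjunct2]])
  qed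
  then have "\<forall>i\<ge>1. ?level i"
    by (intro allI impI)
  then show ?thesis
    unfolding oseledets_infinite_def
    by (rule conjI[OF full conjI[OF D2[THEN conjunct1] conjI[OF D2[THEN conjunct2, THEN conjunct1]]]])
qed

lemma oseledets_decomposition_mono:
  assumes "\<Omega>' \<subseteq> \<Omega>" "full_invariant_set M T \<theta> \<Omega>'" "oseledets_decomposition M T \<theta> U \<Omega> E"
  shows "oseledets_decomposition M T \<theta> U \<Omega>' E"
  using assms(3) unfolding oseledets_decomposition_def
  by (elim disjE exE)
    (rule disjI1, intro exI, erule oseledets_finite_mono[OF assms(1,2)],
     rule disjI2, intro exI, erule oseledets_infinite_mono[OF assms(1,2)])

section \<open>Positive entire orbits in the principal Oseledets subspace\<close>

theorem theorem3p5:
  fixes M :: "'w measure" and T :: "real set" and \<theta> :: "real \<Rightarrow> 'w \<Rightarrow> 'w"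
    and U :: "'w \<Rightarrow> real \<Rightarrow> 'a::{banach, second_countable_topology} \<Rightarrow> 'a"
    and C :: "'a set" and \<Omega>0 :: "'w set" and E :: "nat \<Rightarrow> 'w \<Rightarrow> 'a set"
  assumes "order_cone C"
    and "\<exists>B::'a set. independent B \<and> card B = 2"
    and "total_cone C"
    and "linear_skew_product M T \<theta> U"
    and "integrable_system M T \<theta> U"
    and "injective_system M U"
    and "compact_system M U"
    and "positive_system M T U C"
    and "oseledets_decomposition M T \<theta> U \<Omega>0 E"
  shows "positive_principal_set \<Omega>0 E C \<in> sets M \<and>
    measure M (positive_principal_set \<Omega>0 E C) = 1 \<and>
    (\<exists>\<Omega>'\<subseteq>\<Omega>0.
       oseledets_decomposition M T \<theta> U \<Omega>' E \<and>
       measure M (positive_principal_set \<Omega>' E C) = 1 \<and>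
       (\<forall>\<omega>\<in>positive_principal_set \<Omega>' E C.
          \<exists>v. v \<in> T \<rightarrow> C \<and> entire_orbit T \<theta> U \<omega> v \<and>
              (\<forall>t\<in>T. v t \<in> (E 1 (\<theta> t \<omega>) \<inter> C) - {0})))"
proof -
  interpret linear_skew_product M T \<theta> U by (rule assms(4))
  have "\<exists>F. dominated_splitting M T \<theta> U \<Omega>0 (E 1) F"
    using assms(9) unfolding oseledets_decomposition_def
    by (elim disjE exE)
      (rule exI, erule oseledets_finite_dominated_splitting,
       rule exI, erule oseledets_infinite_dominated_splitting)
  then obtain F where "dominated_splitting M T \<theta> U \<Omega>0 (E 1) F" ..
  then interpret dominated_splitting M T \<theta> U \<Omega>0 "E 1" F .
  interpret positive_dominated_splitting M T \<theta> U \<Omega>0 "E 1" F C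
    using assms by unfold_locales
  have zero: "0 \<in> E 1 \<omega> \<inter> C" if "\<omega> \<in> \<Omega>0" for \<omega>
    using subspace_0[OF subspace_E[OF that]] C_0 by simp
  have eq0: "positive_principal_set \<Omega>0 E C = positive_set"
    using zero unfolding positive_principal_set_def positive_set_def by blast
  have sub: "past_positive_set \<subseteq> \<Omega>0"
    unfolding past_positive_set_def by blast
  then have eq: "positive_principal_set past_positive_set E C = past_positive_set"
    using zero past_positive_set_subset unfolding positive_principal_set_def positive_set_def by blast
  have "\<exists>v. v \<in> T \<rightarrow> C \<and> entire_orbit T \<theta> U \<omega> v \<and> (\<forall>t\<in>T. v t \<in> (E 1 (\<theta> t \<omega>) \<inter> C) - {0})"
    if "\<omega> \<in> past_positive_set" for \<omega>
    using exists_positive_entire_orbit[OF that] by blast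
  moreover have "oseledets_decomposition M T \<theta> U past_positive_set E"
    using oseledets_decomposition_mono[OF sub past_positive_full_invariant assms(9)] .
  ultimately have "past_positive_set \<subseteq> \<Omega>0 \<and>
      oseledets_decomposition M T \<theta> U past_positive_set E \<and>
      measure M (positive_principal_set past_positive_set E C) = 1 \<and>
      (\<forall>\<omega>\<in>positive_principal_set past_positive_set E C.
         \<exists>v. v \<in> T \<rightarrow> C \<and> entire_orbit T \<theta> U \<omega> v \<and>
             (\<forall>t\<in>T. v t \<in> (E 1 (\<theta> t \<omega>) \<inter> C) - {0}))"
    unfolding eq using sub measure_past_positive_set by (intro conjI ballI)
  then show ?thesis
    unfolding eq0 by (rule conjI[OF positive_set_measurable conjI[OF measure_positive_set exI]])
qed

end
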